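(* For integers $a\ge2$ and $b\ge2$, $$\frac b2\,B(\mathcal P_{2a+1})\le B(\mathcal S_{a,b})\le\Bigl(\frac12\ln(3a+1)+T_1^\infty+\gamma-2\Bigr)ab+o(a)\,b,$$ where $\gamma$ is Euler's constant, $T_1^\infty=\sum_{l=3}^\infty\bigl(\frac{l}{l^2-l+1}-\frac1l\bigr)$ is absolutely convergent, and $o(a)$ denotes a quantity depending only on $a$ with $o(a)/a\to0$ as $a\to\infty$.
   Context: $\mathcal P_n$ denotes the path on $n$ vertices. The spider $\mathcal S_{a,b}$ ($a\ge1$, $b\ge2$) is the tree consisting of $b$ paths, each with $a$ edges, sharing one common endpoint (the center). For a connected graph $G$, $\kappa(G)$ is Kemeny's constant of the simple random walk on $G$: $\kappa(G)=\sum_{j\ne i}m_{ij}\pi_j$ ($m_{ij}$ mean first passage time, $\pi$ stationary distribution). A pair of nonadjacent vertices is a Braess edge of $G$ if adding the edge between them strictly increases $\kappa$; $B(G)$ denotes the number of Braess edges of $G$. *)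

theory Defs
  imports "HOL-Probability.Probability" "HOL-Library.Landau_Symbols"
begin

section \<open>Simple graphs\<close>

text \<open>
  A simple graph is given by its vertex set and its set of edges, an edge being an unordered
  pair \<open>{u, v}\<close> of distinct vertices. The definitions below are only meaningful for finite
  connected graphs with at least two vertices.
\<close>

record 'a sgraph =
  verts :: "'a set"
  edges :: "'a set set"

definition nbrs :: "'a sgraph \<Rightarrow> 'a \<Rightarrow> 'a set" where
  "nbrs G v = {u \<in> verts G. {v, u} \<in> edges G}"

definition nonedges :: "'a sgraph \<Rightarrow> 'a set set" where
  "nonedges G = {{u, v} | u v. u \<in> verts G \<and> v \<in> verts G \<and> u \<noteq> v \<and> {u, v} \<notin> edges G}"

definition add_edge :: "'a sgraph \<Rightarrow> 'a set \<Rightarrow> 'a sgraph" where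
  "add_edge G e = \<lparr>verts = verts G, edges = insert e (edges G)\<rparr>"

section \<open>The simple random walk and Kemeny's constant\<close>

definition step :: "'a sgraph \<Rightarrow> 'a \<Rightarrow> 'a pmf" where
  "step G v = pmf_of_set (nbrs G v)"

text \<open>
  The law of the trajectory \<open>[X\<^sub>0, \<dots>, X\<^sub>n]\<close> of the walk started at \<open>X\<^sub>0 = v\<close>.
\<close>

primrec walk :: "'a sgraph \<Rightarrow> nat \<Rightarrow> 'a \<Rightarrow> 'a list pmf" where
  "walk G 0 v = return_pmf [v]"
| "walk G (Suc n) v = bind_pmf (step G v) (\<lambda>w. map_pmf (\<lambda>xs. v # xs) (walk G n w))"

text \<open>
  For \<open>n \<ge> 1\<close>, the probability that the walk started at \<open>i\<close> visits \<open>j\<close> at time \<open>n\<close> and at no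
  time in \<open>1, \<dots>, n - 1\<close>.
\<close>

definition first_passage_prob :: "'a sgraph \<Rightarrow> 'a \<Rightarrow> 'a \<Rightarrow> nat \<Rightarrow> real" where
  "first_passage_prob G i j n =
     measure_pmf.prob (walk G n i) {xs. xs ! n = j \<and> (\<forall>k\<in>{1..<n}. xs ! k \<noteq> j)}"

definition mean_first_passage :: "'a sgraph \<Rightarrow> 'a \<Rightarrow> 'a \<Rightarrow> real" where
  "mean_first_passage G i j = (\<Sum>n. real n * first_passage_prob G i j n)"

definition stationary :: "'a sgraph \<Rightarrow> 'a pmf" where
  "stationary G = (THE p. set_pmf p \<subseteq> verts G \<and> bind_pmf p (step G) = p)"

text \<open>
  The sum defining Kemeny's constant does not depend on the initial vertex \<open>i\<close>; the definite
  description picks out the common value.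
\<close>

definition kemeny :: "'a sgraph \<Rightarrow> real" where
  "kemeny G = (THE c. \<forall>i\<in>verts G.
     (\<Sum>j\<in>verts G - {i}. mean_first_passage G i j * pmf (stationary G) j) = c)"

definition braess_edges :: "'a sgraph \<Rightarrow> 'a set set" where
  "braess_edges G = {e \<in> nonedges G. kemeny (add_edge G e) > kemeny G}"

definition num_braess :: "'a sgraph \<Rightarrow> nat" where
  "num_braess G = card (braess_edges G)"

section \<open>Paths and spiders\<close>

definition path_graph :: "nat \<Rightarrow> nat sgraph" where
  "path_graph n = \<lparr>verts = {..<n}, edges = {{i, Suc i} | i. Suc i < n}\<rparr>"

text \<open>
  \<open>leg_vertex i k\<close> is the vertex at distance \<open>k\<close> from the center on the \<open>i\<close>-th leg; all legs
  share the center \<open>(0, 0)\<close>.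
\<close>

definition leg_vertex :: "nat \<Rightarrow> nat \<Rightarrow> nat \<times> nat" where
  "leg_vertex i k = (if k = 0 then (0, 0) else (i, k))"

definition spider :: "nat \<Rightarrow> nat \<Rightarrow> (nat \<times> nat) sgraph" where
  "spider a b = \<lparr>verts = {leg_vertex i k | i k. i < b \<and> k \<le> a},
     edges = {{leg_vertex i k, leg_vertex i (Suc k)} | i k. i < b \<and> k < a}\<rparr>"

section \<open>The constant in the upper bound\<close>

definition T1_term :: "nat \<Rightarrow> real" where
  "T1_term l = real l / ((real l)\<^sup>2 - real l + 1) - 1 / real l"

definition T1_inf :: real where
  "T1_inf = (\<Sum>l. T1_term (l + 3))"

end

theory Submission
  imports Defs "HOL-Real_Asymp.Real_Asymp"
begin

text \<open>
  If the Laplacian of \<open>G\<close> maps the columns of a symmetric matrix \<open>r\<close> with zero diagonal to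
  \<open>\<tau> - 2 \<delta>\<^sub>y\<close>, with \<open>\<tau>\<close> the same for all \<open>y\<close>, then the hitting times and the stationary distribution
  can be read off \<open>r\<close>, and \<open>\<kappa>(G) = (\<Sum>\<^sub>x\<^sub>,\<^sub>y d\<^sub>x d\<^sub>y r(x, y)) / (2 \<Sum>\<^sub>x d\<^sub>x)\<close>. For a tree, \<open>r\<close> is the
  graph distance; adding an edge changes \<open>r\<close> by an explicit rank-one term. For the spider with \<open>m = a b\<close>
  edges this turns the Braess condition into polynomial inequalities. Pairs on different legs
  are never Braess. A pair on one leg at distance \<open>R\<close>, whose outer vertex is at distance \<open>c\<close> from the
  leaf, is Braess iff \<open>\<beta> - m E > 0\<close> with \<open>\<beta>\<close> and
  \<open>E = c (R\<^sup>2 + R + 1) / (R + 1) + R (R + 2) / 3 - a\<close> independent of \<open>b\<close>. The key point is that the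
  condition forces \<open>E < 0\<close>. So the number of Braess pairs per leg increases with \<open>b\<close>, and \<open>b = 2\<close> is
  the path, which gives the lower bound. Moreover \<open>E < 0\<close> bounds \<open>c\<close> in terms of
  \<open>l = R + 1 \<le> sqrt (3 a + 1)\<close> by \<open>l / (l\<^sup>2 - l + 1) (a - (l\<^sup>2 - 1) / 3)\<close>, and summing over \<open>l\<close> gives the upper bound.
\<close>

section \<open>Hitting times\<close>

abbreviation deg :: "'a sgraph \<Rightarrow> 'a \<Rightarrow> real" where
  "deg G v \<equiv> real (card (nbrs G v))"

text \<open>Nonempty finite neighbourhoods make \<open>step\<close> a genuine uniform choice.
  Connectedness enters through the existence of a \<open>resistance\<close>.\<close>

definition walkable :: "'a sgraph \<Rightarrow> bool" where
  "walkable G \<longleftrightarrow> finite (verts G) \<and> verts G \<noteq> {} \<and> (\<forall>v\<in>verts G. nbrs G v \<noteq> {})"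

lemma nbrs_subset: "nbrs G v \<subseteq> verts G"
  by (auto simp: nbrs_def)

lemma nbrs_sym: "u \<in> verts G \<Longrightarrow> v \<in> nbrs G u \<Longrightarrow> u \<in> nbrs G v"
  by (auto simp: nbrs_def insert_commute)

lemma walkable_finite_nbrs: "walkable G \<Longrightarrow> finite (nbrs G v)"
  using nbrs_subset[of G v] by (auto simp: walkable_def intro: finite_subset)

lemma walkable_deg_pos: "walkable G \<Longrightarrow> v \<in> verts G \<Longrightarrow> deg G v > 0"
  using walkable_finite_nbrs[of G v] by (auto simp: walkable_def card_gt_0_iff)

section \<open>First-step analysis of first passage times\<close>

lemma prob_walk_Suc:
  assumes "walkable G" "v \<in> verts G"
  shows "measure_pmf.prob (walk G (Suc n) v) A =
    (\<Sum>w\<in>nbrs G v. measure_pmf.prob (walk G n w) {xs. v # xs \<in> A}) / deg G v"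
proof -
  have fin: "finite (nbrs G v)" and ne: "nbrs G v \<noteq> {}"
    using assms by (auto simp: walkable_def walkable_finite_nbrs)
  have "measure_pmf.prob (walk G (Suc n) v) A =
    measure_pmf.expectation (step G v) (\<lambda>w. measure_pmf.prob (map_pmf (\<lambda>xs. v # xs) (walk G n w)) A)"
    unfolding walk.simps measure_pmf_bind
    by (intro measure_pmf.measure_bind[where N = "count_space UNIV"]) (auto simp: measure_subprob)
  also have "\<dots> = (\<Sum>w\<in>nbrs G v. measure_pmf.prob (map_pmf (\<lambda>xs. v # xs) (walk G n w)) A) / deg G v"
    unfolding step_def by (rule integral_pmf_of_set[OF ne fin])
  finally show ?thesis by (simp add: vimage_def)
qed

lemma walk_hd: "xs \<in> set_pmf (walk G n v) \<Longrightarrow> xs ! 0 = v"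
  by (cases n) auto

text \<open>The probability that the walk from \<open>v\<close> avoids \<open>j\<close> at times
  \<open>1, ..., n\<close>. Time \<open>0\<close> is not inspected, so the value 1 at
  \<open>n = 0\<close> also holds for \<open>v = j\<close>.\<close>

primrec survival :: "'a sgraph \<Rightarrow> 'a \<Rightarrow> nat \<Rightarrow> 'a \<Rightarrow> real" where
  "survival G j 0 v = 1"
| "survival G j (Suc n) v = (\<Sum>w\<in>nbrs G v - {j}. survival G j n w) / deg G v"

lemma first_passage_prob_Suc_0:
  assumes G: "walkable G" and v: "v \<in> verts G"
  shows "first_passage_prob G v j (Suc 0) = 1 - survival G j (Suc 0) v"
proof -
  have fin: "finite (nbrs G v)" using G by (rule walkable_finite_nbrs)
  have d: "deg G v > 0" by (rule walkable_deg_pos[OF G v])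
  have "first_passage_prob G v j (Suc 0) = (\<Sum>w\<in>nbrs G v. if w = j then 1 else 0) / deg G v"
    unfolding first_passage_prob_def prob_walk_Suc[OF G v] by (simp add: indicator_def of_bool_def)
  also have "(\<Sum>w\<in>nbrs G v. if w = j then 1 else (0::real)) = deg G v - real (card (nbrs G v - {j}))"
  proof (cases "j \<in> nbrs G v")
    case True
    then have "card (nbrs G v) = Suc (card (nbrs G v - {j}))" by (metis card.remove fin)
    then show ?thesis using True fin by simp
  qed (use fin in simp)
  finally show ?thesis using d by (simp add: diff_divide_distrib)
qed

lemma first_passage_prob_Suc_Suc:
  assumes G: "walkable G" and v: "v \<in> verts G"
  shows "first_passage_prob G v j (Suc (Suc n)) =
    (\<Sum>w\<in>nbrs G v - {j}. first_passage_prob G w j (Suc n)) / deg G v"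
proof -
  have fin: "finite (nbrs G v)" using G by (rule walkable_finite_nbrs)
  have *: "measure_pmf.prob (walk G (Suc n) w)
      {xs. (v # xs) ! Suc (Suc n) = j \<and> (\<forall>k\<in>{1..<Suc (Suc n)}. (v # xs) ! k \<noteq> j)} =
    (if w = j then 0 else first_passage_prob G w j (Suc n))" for w
  proof -
    \<comment> \<open>Times \<open>1, ..., n + 1\<close> of \<open>v # xs\<close> are times
      \<open>0, ..., n\<close> of \<open>xs\<close>. Index \<open>0\<close> of \<open>xs\<close> is
      the first step \<open>w\<close>, whence the case \<open>w = j\<close>.\<close>
    have split: "{1..<Suc (Suc n)} = Suc ` insert 0 {1..<Suc n}"
      by (auto simp: image_iff)
    have ev: "(\<forall>k\<in>{1..<Suc (Suc n)}. (v # xs) ! k \<noteq> j) \<longleftrightarrow>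
        xs ! 0 \<noteq> j \<and> (\<forall>k\<in>{1..<Suc n}. xs ! k \<noteq> j)" for xs
      unfolding split by (simp del: image_Suc_atLeastLessThan)
    show ?thesis
    proof (cases "w = j")
      case True
      then have "measure_pmf.prob (walk G (Suc n) w)
          {xs. (v # xs) ! Suc (Suc n) = j \<and> xs ! 0 \<noteq> j \<and> (\<forall>k\<in>{1..<Suc n}. xs ! k \<noteq> j)} = 0"
        by (subst measure_pmf_zero_iff) (use walk_hd in fastforce)
      then show ?thesis using True by (simp only: ev) simp
    next
      case False
      then show ?thesis unfolding ev first_passage_prob_def
        by (simp, intro measure_pmf.finite_measure_eq_AE)
          (auto simp: AE_measure_pmf_iff dest: walk_hd)
    qed
  qed
  have "first_passage_prob G v j (Suc (Suc n)) =
      (\<Sum>w\<in>nbrs G v. if w = j then 0 else first_passage_prob G w j (Suc n)) / deg G v"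
    unfolding first_passage_prob_def[of G v] prob_walk_Suc[OF G v] mem_Collect_eq * ..
  also have "(\<Sum>w\<in>nbrs G v. if w = j then 0 else first_passage_prob G w j (Suc n)) =
      (\<Sum>w\<in>nbrs G v - {j}. first_passage_prob G w j (Suc n))"
    by (rule sum.mono_neutral_cong_right) (use fin in auto)
  finally show ?thesis .
qed

text \<open>A first passage at time \<open>n + 1\<close> means surviving \<open>n\<close> steps but
  not \<open>n + 1\<close>.\<close>

lemma first_passage_prob_eq_survival_diff:
  assumes G: "walkable G" and v: "v \<in> verts G"
  shows "first_passage_prob G v j (Suc n) = survival G j n v - survival G j (Suc n) v"
  using v
proof (induction n arbitrary: v)
  case 0
  then show ?case using first_passage_prob_Suc_0[OF G] by simp
next
  case (Suc n)
  have "first_passage_prob G v j (Suc (Suc n)) =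
    (\<Sum>w\<in>nbrs G v - {j}. survival G j n w - survival G j (Suc n) w) / deg G v"
    unfolding first_passage_prob_Suc_Suc[OF G Suc.prems]
    using Suc.IH nbrs_subset[of G v] by (intro arg_cong2[where f = "(/)"] sum.cong) auto
  then show ?case by (simp add: sum_subtractf diff_divide_distrib)
qed

lemma survival_nonneg: "survival G j n v \<ge> 0"
  by (induction n arbitrary: v) (auto intro!: divide_nonneg_nonneg sum_nonneg)

text \<open>
  With \<open>h \<ge> 0\<close> the equations force \<open>h \<ge> 1\<close> off the target, so one step of the killed walk multiplies \<open>h\<close> by at
  most \<open>1 - 1 / max h\<close>. This is where geometric tails of the hitting time come from.
\<close>

lemma mean_first_passage_eqI:
  assumes G: "walkable G" and j: "j \<in> verts G" and i: "i \<in> verts G" "i \<noteq> j"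
    and hj: "h j = 0"
    and h: "\<And>v. v \<in> verts G \<Longrightarrow> v \<noteq> j \<Longrightarrow> deg G v * h v = deg G v + (\<Sum>w\<in>nbrs G v. h w)"
  shows "mean_first_passage G i j = h i"
proof -
  have finV: "finite (verts G)" using G by (simp add: walkable_def)
  have fin: "finite (nbrs G v)" for v using G by (rule walkable_finite_nbrs)
  have nonneg: "h v \<ge> 0" if v: "v \<in> verts G" for v
  proof -
    \<comment> \<open>Minimum principle: at a minimiser \<open>x\<close> other than
      \<open>j\<close>, the neighbours average at least \<open>h x\<close>, against the positive
      source \<open>deg G x\<close>.\<close>
    obtain x where x: "x \<in> verts G" "\<And>y. y \<in> verts G \<Longrightarrow> h x \<le> h y"
      using finV j by (metis (no_types, lifting) arg_min_if_finite(1) arg_min_least empty_iff)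
    have "x = j"
    proof (rule ccontr)
      assume "x \<noteq> j"
      have "(\<Sum>w\<in>nbrs G x. h x) \<le> (\<Sum>w\<in>nbrs G x. h w)"
        using x nbrs_subset[of G x] by (intro sum_mono) auto
      then show False using h[OF x(1) \<open>x \<noteq> j\<close>] walkable_deg_pos[OF G x(1)] by simp
    qed
    then show ?thesis using x(2)[OF v] hj by simp
  qed
  define killed where "killed f v = (\<Sum>w\<in>nbrs G v - {j}. f w) / deg G v" for f :: "'a \<Rightarrow> real" and v
  have killed_h: "killed h v = h v - 1" if "v \<in> verts G" "v \<noteq> j" for v
  proof -
    have "(\<Sum>w\<in>nbrs G v - {j}. h w) = (\<Sum>w\<in>nbrs G v. h w)"
      by (rule sum.mono_neutral_left) (use fin hj in auto)
    then show ?thesis using h[OF that] walkable_deg_pos[OF G that(1)]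
      by (simp add: killed_def field_simps)
  qed
  have killed_mono: "killed f v \<le> killed g v"
    if "v \<in> verts G" "\<And>w. w \<in> verts G \<Longrightarrow> w \<noteq> j \<Longrightarrow> f w \<le> g w" for f g v
    unfolding killed_def using that nbrs_subset[of G v] by (intro divide_right_mono sum_mono) auto
  have killed_scale: "killed (\<lambda>w. c * f w) v = c * killed f v" for c f v
    by (simp add: killed_def sum_distrib_left)
  have h_ge_1: "h v \<ge> 1" if "v \<in> verts G" "v \<noteq> j" for v
    using killed_h[OF that] killed_mono[of v "\<lambda>_. 0" h] that nonneg by (simp add: killed_def)
  define M where "M = Max (h ` verts G)"
  have h_le: "h v \<le> M" if "v \<in> verts G" for v
    using finV that by (simp add: M_def)
  have M: "M \<ge> 1" using h_ge_1[OF i] h_le[OF i(1)] by simp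
  \<comment> \<open>\<open>h v - 1 \<le> \<rho> * h v\<close> holds whenever
    \<open>h v \<le> M\<close>.\<close>
  define \<rho> where "\<rho> = 1 - 1 / M"
  have \<rho>: "0 \<le> \<rho>" "\<rho> < 1" using M by (auto simp: \<rho>_def)
  have contract: "killed f v \<le> \<rho> ^ Suc n * h v"
    if v: "v \<in> verts G" "v \<noteq> j" and f: "\<And>w. w \<in> verts G \<Longrightarrow> w \<noteq> j \<Longrightarrow> f w \<le> \<rho> ^ n * h w" for f v n
  proof -
    have "killed f v \<le> \<rho> ^ n * (h v - 1)"
      using killed_mono[of v f "\<lambda>w. \<rho> ^ n * h w"] v f by (simp add: killed_scale killed_h)
    also have "\<dots> \<le> \<rho> ^ n * (\<rho> * h v)"
      using \<rho> h_le[OF v(1)] M by (intro mult_left_mono) (auto simp: \<rho>_def field_simps)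
    finally show ?thesis by (simp add: mult_ac)
  qed
  have surv_le: "survival G j n v \<le> \<rho> ^ n * h v" if "v \<in> verts G" "v \<noteq> j" for n v
    using that
  proof (induction n arbitrary: v)
    case 0
    then show ?case using h_ge_1 by simp
  next
    case (Suc n)
    then show ?case using contract[of v "survival G j n" n] by (simp add: killed_def)
  qed
  \<comment> \<open>The remainder of the partial sums obeys the recursion of the killed walk, since
    survival at time 0 accounts for the 1 in \<open>killed_h\<close>. So it tends to 0 and
    \<open>h\<close> is the sum of the survival probabilities.\<close>
  have rest: "h v - (\<Sum>k<n. survival G j k v) \<in> {0..\<rho> ^ n * h v}" if "v \<in> verts G" "v \<noteq> j" for n v
    using that
  proof (induction n arbitrary: v)
    case 0
    then show ?case using nonneg by simp
  next
    case (Suc n)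
    define f where "f w = h w - (\<Sum>k<n. survival G j k w)" for w
    have "h v - (\<Sum>k<Suc n. survival G j k v) = killed f v"
      using killed_h[OF Suc.prems]
      by (simp add: sum.lessThan_Suc_shift f_def killed_def sum_subtractf diff_divide_distrib
          sum_divide_distrib[symmetric] sum.swap[of _ "{..<n}"] del: sum.lessThan_Suc)
    moreover have "killed f v \<le> \<rho> ^ Suc n * h v"
      using Suc by (intro contract) (auto simp: f_def)
    moreover have "killed f v \<ge> 0"
      using killed_mono[of v "\<lambda>_. 0" f] Suc by (simp add: killed_def f_def)
    ultimately show ?case by simp
  qed
  have pow: "(\<lambda>n. \<rho> ^ n * h i) \<longlonglongrightarrow> 0"
    by (rule tendsto_eq_intros LIMSEQ_realpow_zero[OF \<rho>] refl)+ simp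
  have npow: "(\<lambda>n. real n * \<rho> ^ n * h i) \<longlonglongrightarrow> 0"
    using tendsto_mult_right[OF powser_times_n_limit_0[of \<rho>], of "h i"] \<rho> by simp
  have "(\<lambda>n. h i - (\<Sum>k<n. survival G j k i)) \<longlonglongrightarrow> 0"
    by (rule tendsto_sandwich[OF _ _ tendsto_const pow]) (use rest[OF i] in auto)
  moreover have "(\<lambda>n. real n * survival G j n i) \<longlonglongrightarrow> 0"
    by (rule tendsto_sandwich[OF _ _ tendsto_const npow])
      (use surv_le[OF i] survival_nonneg[of G j _ i] in
        \<open>auto simp: mult.assoc intro!: always_eventually mult_left_mono\<close>)
  ultimately have lim: "(\<lambda>n. h i - ((h i - (\<Sum>k<n. survival G j k i)) + real n * survival G j n i)) \<longlonglongrightarrow> h i - (0 + 0)"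
    by (intro tendsto_intros)
  \<comment> \<open>Summation by parts turns the expectation into a sum of tails; the boundary term
    vanishes by the geometric bound.\<close>
  have "(\<Sum>k<Suc n. real k * first_passage_prob G i j k) =
      (\<Sum>k<n. survival G j k i) - real n * survival G j n i" for n
  proof (induction n)
    case (Suc n)
    show ?case
      unfolding sum.lessThan_Suc[of _ "Suc n"] Suc first_passage_prob_eq_survival_diff[OF G i(1)]
      by (simp add: algebra_simps del: survival.simps)
  qed simp
  then have "(\<lambda>n. \<Sum>k<Suc n. real k * first_passage_prob G i j k) \<longlonglongrightarrow> h i"
    using lim by simp
  then have "(\<lambda>k. real k * first_passage_prob G i j k) sums h i"
    unfolding sums_def by (rule LIMSEQ_imp_Suc)
  then show ?thesis by (simp add: mean_first_passage_def sums_iff)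
qed

section \<open>Resistances and Kemeny's constant\<close>

abbreviation vol :: "'a sgraph \<Rightarrow> real" where
  "vol G \<equiv> \<Sum>v\<in>verts G. deg G v"

text \<open>
  The effective resistance satisfies the axioms below, and these are all that is needed of it: in matrix
  form, the Laplacian of \<open>G\<close> applied to \<open>r\<close> is \<open>\<tau> 1\<^sup>T - 2 I\<close> for some vector \<open>\<tau>\<close>.
\<close>

definition resistance :: "'a sgraph \<Rightarrow> ('a \<Rightarrow> 'a \<Rightarrow> real) \<Rightarrow> bool" where
  "resistance G r \<longleftrightarrow> walkable G \<and> (\<forall>x\<in>verts G. r x x = 0) \<and>
     (\<forall>x\<in>verts G. \<forall>y\<in>verts G. r x y = r y x) \<and>
     (\<exists>\<tau>. \<forall>x\<in>verts G. \<forall>y\<in>verts G.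
        (\<Sum>z\<in>nbrs G x. r x y - r z y) = \<tau> x - (if x = y then 2 else 0))"

text \<open>Tetali's formula for expected hitting times in terms of effective resistances.\<close>

definition hitting_time :: "'a sgraph \<Rightarrow> ('a \<Rightarrow> 'a \<Rightarrow> real) \<Rightarrow> 'a \<Rightarrow> 'a \<Rightarrow> real" where
  "hitting_time G r x y = (\<Sum>z\<in>verts G. deg G z * (r x y + r y z - r x z)) / 2"

text \<open>Only differences of two columns of \<open>r\<close> occur, so the unknown \<tau> cancels
  and the point masses survive. The one at \<open>y\<close> has weight \<open>vol G\<close>, which
  encodes the mean return time \<open>vol G / deg G y\<close>.\<close>

lemma hitting_time_laplacian:
  assumes r: "resistance G r" and x: "x \<in> verts G" and y: "y \<in> verts G"
  shows "deg G x * hitting_time G r x y =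
    deg G x - (if x = y then vol G else 0) + (\<Sum>k\<in>nbrs G x. hitting_time G r k y)"
proof -
  obtain \<tau> where \<tau>: "\<And>x y. x \<in> verts G \<Longrightarrow> y \<in> verts G \<Longrightarrow>
      (\<Sum>z\<in>nbrs G x. r x y - r z y) = \<tau> x - (if x = y then 2 else 0)"
    using r by (auto simp: resistance_def)
  have fin: "finite (verts G)" using r by (simp add: resistance_def walkable_def)
  have "deg G x * hitting_time G r x y - (\<Sum>k\<in>nbrs G x. hitting_time G r k y)
      = (\<Sum>k\<in>nbrs G x. hitting_time G r x y - hitting_time G r k y)"
    by (simp add: sum_subtractf)
  also have "\<dots> = (\<Sum>k\<in>nbrs G x. \<Sum>z\<in>verts G. deg G z * ((r x y - r k y) - (r x z - r k z)) / 2)"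
    unfolding hitting_time_def diff_divide_distrib[symmetric] sum_subtractf[symmetric] sum_divide_distrib
    by (intro sum.cong refl) (simp add: algebra_simps)
  also have "\<dots> = (\<Sum>z\<in>verts G. deg G z * ((\<Sum>k\<in>nbrs G x. r x y - r k y) - (\<Sum>k\<in>nbrs G x. r x z - r k z)) / 2)"
    by (subst sum.swap) (simp only: sum_subtractf[symmetric] sum_distrib_left sum_divide_distrib)
  also have "\<dots> = (\<Sum>z\<in>verts G. (if x = z then deg G z else 0) - (if x = y then deg G z else 0))"
    using x y by (intro sum.cong refl) (simp add: \<tau>)
  also have "\<dots> = deg G x - (if x = y then vol G else 0)"
    using fin x by (simp add: sum_subtractf)
  finally show ?thesis by simp
qed

lemma resistance_mean_first_passage:
  assumes r: "resistance G r" and x: "x \<in> verts G" and y: "y \<in> verts G" "x \<noteq> y"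
  shows "mean_first_passage G x y = hitting_time G r x y"
proof (rule mean_first_passage_eqI[where h = "\<lambda>v. hitting_time G r v y"])
  show "hitting_time G r y y = 0" using r y by (simp add: hitting_time_def resistance_def)
qed (use r x y hitting_time_laplacian[OF r _ y(1)] in \<open>auto simp: resistance_def\<close>)

section \<open>The stationary distribution\<close>

lemma vol_pos: "walkable G \<Longrightarrow> vol G > 0"
  using walkable_deg_pos[of G] by (intro sum_pos) (auto simp: walkable_def)

lemma pmf_bind_step:
  assumes G: "walkable G" and p: "set_pmf p \<subseteq> verts G"
  shows "pmf (bind_pmf p (step G)) w = (\<Sum>v\<in>verts G. pmf p v * of_bool (w \<in> nbrs G v) / deg G v)"
proof -
  have "pmf (bind_pmf p (step G)) w = (\<Sum>v\<in>verts G. pmf p v *\<^sub>R pmf (step G v) w)"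
    unfolding pmf_bind by (rule integral_measure_pmf) (use G p in \<open>auto simp: walkable_def\<close>)
  also have "\<dots> = (\<Sum>v\<in>verts G. pmf p v * of_bool (w \<in> nbrs G v) / deg G v)"
    using G by (intro sum.cong refl)
      (simp add: step_def pmf_of_set walkable_finite_nbrs walkable_def indicator_def)
  finally show ?thesis .
qed

text \<open>The average of the hitting time of \<open>y\<close> under an invariant law is the same
  before and after a step. A step lowers it by 1 and raises it by
  \<open>pmf p y * vol G / deg G y\<close>, so these two balance.\<close>

lemma bind_step_eq_imp_pmf:
  assumes r: "resistance G r" and p: "set_pmf p \<subseteq> verts G" "bind_pmf p (step G) = p" and y: "y \<in> verts G"
  shows "pmf p y = deg G y / vol G"
proof -
  define h where "h v = hitting_time G r v y" for v
  have G: "walkable G" and fin: "finite (verts G)" using r by (auto simp: resistance_def walkable_def)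
  have one: "(\<Sum>v\<in>verts G. pmf p v) = 1" using fin p(1) by (rule sum_pmf_eq_1)
  have nb: "(\<Sum>w\<in>verts G. of_bool (w \<in> nbrs G v) * h w) = (\<Sum>w\<in>nbrs G v. h w)" for v
    using fin nbrs_subset[of G v] by (intro sum.mono_neutral_cong_right) auto
  have "(\<Sum>w\<in>verts G. pmf p w * h w) =
      (\<Sum>w\<in>verts G. \<Sum>v\<in>verts G. pmf p v / deg G v * (of_bool (w \<in> nbrs G v) * h w))"
  proof (intro sum.cong refl)
    fix w
    have "pmf p w = (\<Sum>v\<in>verts G. pmf p v * of_bool (w \<in> nbrs G v) / deg G v)"
      using pmf_bind_step[OF G p(1), of w] unfolding p(2) .
    then have "pmf p w * h w = (\<Sum>v\<in>verts G. pmf p v * of_bool (w \<in> nbrs G v) / deg G v) * h w" by simp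
    then show "pmf p w * h w = (\<Sum>v\<in>verts G. pmf p v / deg G v * (of_bool (w \<in> nbrs G v) * h w))"
      unfolding sum_distrib_right by (simp add: mult.assoc)
  qed
  also have "\<dots> = (\<Sum>v\<in>verts G. pmf p v / deg G v * (\<Sum>w\<in>nbrs G v. h w))"
    by (subst sum.swap) (simp only: sum_distrib_left[symmetric] nb)
  also have "\<dots> = (\<Sum>v\<in>verts G. pmf p v * h v - pmf p v + (if v = y then pmf p y * vol G / deg G y else 0))"
  proof (intro sum.cong refl)
    fix v assume v: "v \<in> verts G"
    have nz: "deg G v \<noteq> 0" using walkable_deg_pos[OF G v] by simp
    have S: "(\<Sum>w\<in>nbrs G v. h w) = deg G v * h v - deg G v + (if v = y then vol G else 0)"
      using hitting_time_laplacian[OF r v y] by (simp add: h_def)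
    show "pmf p v / deg G v * (\<Sum>w\<in>nbrs G v. h w) =
      pmf p v * h v - pmf p v + (if v = y then pmf p y * vol G / deg G y else 0)"
      unfolding S using nz by (auto simp: field_simps)
  qed
  also have "\<dots> = (\<Sum>v\<in>verts G. pmf p v * h v) - 1 + pmf p y * vol G / deg G y"
    using fin y one by (simp add: sum.distrib sum_subtractf)
  finally show ?thesis
    using vol_pos[OF G] walkable_deg_pos[OF G y] by (simp add: field_simps)
qed

text \<open>The witness is the degree distribution: every edge carries mass \<open>1 / vol G\<close>
  in both directions, so each vertex receives what it sends.\<close>

lemma ex_bind_step_eq:
  assumes G: "walkable G"
  shows "\<exists>p. set_pmf p \<subseteq> verts G \<and> bind_pmf p (step G) = p"
proof -
  have fin: "finite (verts G)" using G by (simp add: walkable_def)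
  define f where "f v = (if v \<in> verts G then deg G v / vol G else 0)" for v
  have nonneg: "f v \<ge> 0" for v using vol_pos[OF G] by (simp add: f_def)
  have "(\<integral>\<^sup>+ v. ennreal (f v) \<partial>count_space UNIV) = (\<Sum>v\<in>verts G. ennreal (f v))"
    by (rule nn_integral_count_space'[OF fin]) (auto simp: f_def)
  also have "\<dots> = ennreal (\<Sum>v\<in>verts G. f v)" using nonneg by (rule sum_ennreal)
  also have "(\<Sum>v\<in>verts G. f v) = 1"
    using vol_pos[OF G] by (simp add: f_def sum_divide_distrib[symmetric])
  finally have f: "pmf (embed_pmf f) v = f v" for v
    using nonneg by (intro pmf_embed_pmf) auto
  have sub: "set_pmf (embed_pmf f) \<subseteq> verts G" by (auto simp: set_pmf_iff f f_def split: if_splits)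
  have "bind_pmf (embed_pmf f) (step G) = embed_pmf f"
  proof (rule pmf_eqI)
    fix w
    have "pmf (bind_pmf (embed_pmf f) (step G)) w = (\<Sum>v\<in>verts G. of_bool (w \<in> nbrs G v) / vol G)"
      unfolding pmf_bind_step[OF G sub]
    proof (intro sum.cong refl)
      fix v assume v: "v \<in> verts G"
      show "pmf (embed_pmf f) v * of_bool (w \<in> nbrs G v) / deg G v = of_bool (w \<in> nbrs G v) / vol G"
        using walkable_deg_pos[OF G v] v by (simp add: f f_def)
    qed
    also have "\<dots> = real (card {v \<in> verts G. w \<in> nbrs G v}) / vol G"
      using fin by (simp add: sum_divide_distrib[symmetric] Int_def)
    also have "\<dots> = pmf (embed_pmf f) w"
    proof (cases "w \<in> verts G")
      case True
      then have "{v \<in> verts G. w \<in> nbrs G v} = nbrs G w"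
        using nbrs_sym[of w G] nbrs_sym[of _ G w] nbrs_subset[of G w] by blast
      then show ?thesis using True by (simp add: f f_def)
    next
      case False
      then have "{v \<in> verts G. w \<in> nbrs G v} = {}" using nbrs_subset[of G] by blast
      then show ?thesis using False by (simp add: f f_def del: Collect_empty_eq)
    qed
    finally show "pmf (bind_pmf (embed_pmf f) (step G)) w = pmf (embed_pmf f) w" .
  qed
  then show ?thesis using sub by blast
qed

lemma pmf_stationary:
  assumes r: "resistance G r" and y: "y \<in> verts G"
  shows "pmf (stationary G) y = deg G y / vol G"
proof -
  have G: "walkable G" using r by (simp add: resistance_def)
  obtain p where p: "set_pmf p \<subseteq> verts G" "bind_pmf p (step G) = p"
    using ex_bind_step_eq[OF G] by blast
  \<comment> \<open>Uniqueness is what the definite description in \<open>stationary\<close>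
    requires.\<close>
  have "q = p" if q: "set_pmf q \<subseteq> verts G" "bind_pmf q (step G) = q" for q
  proof (rule pmf_eqI)
    fix v
    show "pmf q v = pmf p v"
    proof (cases "v \<in> verts G")
      case True
      then show ?thesis using bind_step_eq_imp_pmf[OF r p] bind_step_eq_imp_pmf[OF r q] by simp
    next
      case False
      then have "v \<notin> set_pmf p" "v \<notin> set_pmf q" using p(1) q(1) by auto
      then show ?thesis by (simp add: set_pmf_iff)
    qed
  qed
  then have "stationary G = p" unfolding stationary_def using p by (metis (mono_tags, lifting) the_equality)
  then show ?thesis using bind_step_eq_imp_pmf[OF r p y] by simp
qed

definition degree_energy :: "'a sgraph \<Rightarrow> ('a \<Rightarrow> 'a \<Rightarrow> real) \<Rightarrow> real" where
  "degree_energy G r = (\<Sum>x\<in>verts G. \<Sum>y\<in>verts G. deg G x * deg G y * r x y)"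

text \<open>Averaging Tetali's formula over a stationary target, the two terms containing the start
  \<open>x\<close> both become its degree-weighted resistance sum and cancel.\<close>

lemma kemeny_eq:
  assumes r: "resistance G r"
  shows "kemeny G = degree_energy G r / (2 * vol G)"
proof -
  have G: "walkable G" and fin: "finite (verts G)" and ne: "verts G \<noteq> {}"
    using r by (auto simp: resistance_def walkable_def)
  have *: "(\<Sum>y\<in>verts G - {x}. mean_first_passage G x y * pmf (stationary G) y) =
      degree_energy G r / (2 * vol G)" if x: "x \<in> verts G" for x
  proof -
    define \<rho> where "\<rho> = (\<Sum>z\<in>verts G. deg G z * r x z)"
    have "(\<Sum>y\<in>verts G - {x}. mean_first_passage G x y * pmf (stationary G) y) =
        (\<Sum>y\<in>verts G - {x}. hitting_time G r x y * (deg G y / vol G))"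
      using x by (intro sum.cong refl) (auto simp: resistance_mean_first_passage[OF r x] pmf_stationary[OF r])
    also have "\<dots> = (\<Sum>y\<in>verts G. hitting_time G r x y * (deg G y / vol G))"
      using fin x r by (intro sum.mono_neutral_left) (auto simp: hitting_time_def resistance_def)
    also have "\<dots> = (\<Sum>y\<in>verts G. deg G y * (\<Sum>z\<in>verts G. deg G z * (r x y + r y z - r x z))) / (2 * vol G)"
      unfolding hitting_time_def sum_divide_distrib[of _ _ "2 * vol G"]
      by (intro sum.cong refl) (simp add: mult.commute)
    also have "(\<Sum>y\<in>verts G. deg G y * (\<Sum>z\<in>verts G. deg G z * (r x y + r y z - r x z))) =
      (\<Sum>y\<in>verts G. deg G y * r x y * vol G + (\<Sum>z\<in>verts G. deg G y * deg G z * r y z) - deg G y * \<rho>)"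
      unfolding \<rho>_def
      by (intro sum.cong refl) (simp add: algebra_simps sum.distrib sum_subtractf sum_distrib_left)
    also have "\<dots> = \<rho> * vol G + degree_energy G r - vol G * \<rho>"
      by (simp add: sum.distrib sum_subtractf degree_energy_def \<rho>_def sum_distrib_right)
    finally show ?thesis by simp
  qed
  show ?thesis
    unfolding kemeny_def
  proof (rule the_equality)
    fix c
    assume c: "\<forall>i\<in>verts G. (\<Sum>j\<in>verts G - {i}. mean_first_passage G i j * pmf (stationary G) j) = c"
    obtain x where x: "x \<in> verts G" using ne by blast
    show "c = degree_energy G r / (2 * vol G)" using bspec[OF c x] *[OF x] by simp
  qed (use * in blast)
qed

section \<open>Adding an edge\<close>

lemma verts_add_edge [simp]: "verts (add_edge G e) = verts G"
  by (simp add: add_edge_def)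

lemma nbrs_add_edge:
  assumes "u \<in> verts G" "v \<in> verts G" "u \<noteq> v"
  shows "nbrs (add_edge G {u, v}) x =
    nbrs G x \<union> (if x = u then {v} else {}) \<union> (if x = v then {u} else {})"
  using assms by (auto simp: nbrs_def add_edge_def doubleton_eq_iff)

lemma walkable_add_edge:
  assumes "walkable G" "u \<in> verts G" "v \<in> verts G" "u \<noteq> v"
  shows "walkable (add_edge G {u, v})"
  using assms by (auto simp: walkable_def nbrs_add_edge)

lemma sum_nbrs_add_edge:
  assumes G: "walkable G" and uv: "u \<in> verts G" "v \<in> verts G" "u \<noteq> v" "{u, v} \<notin> edges G"
  shows "(\<Sum>z\<in>nbrs (add_edge G {u, v}) x. f z) =
    (\<Sum>z\<in>nbrs G x. f z) + (if x = u then f v else 0) + (if x = v then f u else 0 :: real)"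
proof -
  have "v \<notin> nbrs G u" "u \<notin> nbrs G v" using uv by (auto simp: nbrs_def insert_commute)
  then show ?thesis
    using uv walkable_finite_nbrs[OF G] by (auto simp: nbrs_add_edge[OF uv(1-3)])
qed

lemma deg_add_edge:
  assumes "walkable G" "u \<in> verts G" "v \<in> verts G" "u \<noteq> v" "{u, v} \<notin> edges G"
  shows "deg (add_edge G {u, v}) x = deg G x + of_bool (x = u) + of_bool (x = v)"
  using sum_nbrs_add_edge[OF assms, of "\<lambda>_. 1" x] by simp

lemma sum_deg_add_edge:
  assumes "walkable G" "u \<in> verts G" "v \<in> verts G" "u \<noteq> v" "{u, v} \<notin> edges G"
  shows "(\<Sum>x\<in>verts G. deg (add_edge G {u, v}) x * f x) = (\<Sum>x\<in>verts G. deg G x * f x) + f u + f v"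
proof -
  have "finite (verts G)" using assms by (simp add: walkable_def)
  then show ?thesis
    using assms(2,3) by (simp add: deg_add_edge[OF assms] distrib_right sum.distrib)
qed

text \<open>
  The rank-one update of the resistances when a unit resistor is put between \<open>u\<close> and \<open>v\<close>
  (Sherman--Morrison).
\<close>

definition shortcut :: "('a \<Rightarrow> 'a \<Rightarrow> real) \<Rightarrow> 'a \<Rightarrow> 'a \<Rightarrow> 'a \<Rightarrow> 'a \<Rightarrow> real" where
  "shortcut r u v x y = r x y - ((r x u - r x v) - (r y u - r y v))\<^sup>2 / (4 * (1 + r u v))"

text \<open>Up to a factor, \<phi> below is the potential of a unit current between \<open>u\<close>
  and \<open>v\<close>, so its Laplacian is a dipole. In the squared correction the terms free of
  \<open>y\<close> go into the new \<tau>, and the mixed term creates a dipole that cancels the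
  current through the new edge.\<close>

lemma resistance_shortcut:
  assumes r: "resistance G r" and uv: "u \<in> verts G" "v \<in> verts G" "u \<noteq> v" "{u, v} \<notin> edges G"
    and R: "1 + r u v > 0"
  shows "resistance (add_edge G {u, v}) (shortcut r u v)"
proof -
  have G: "walkable G" using r by (simp add: resistance_def)
  obtain \<tau> where \<tau>: "\<And>x y. x \<in> verts G \<Longrightarrow> y \<in> verts G \<Longrightarrow>
      (\<Sum>z\<in>nbrs G x. r x y - r z y) = \<tau> x - (if x = y then 2 else 0)"
    using r by (auto simp: resistance_def)
  have sym: "r x y = r y x" if "x \<in> verts G" "y \<in> verts G" for x y
    using r that by (auto simp: resistance_def)
  have r0: "r x x = 0" if "x \<in> verts G" for x using r that by (auto simp: resistance_def)
  define \<phi> where "\<phi> x = r x u - r x v" for x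
  define D where "D = 4 * (1 + r u v)"
  have D: "D > 0" using R by (simp add: D_def)
  have \<phi>u: "\<phi> u = - r u v" and \<phi>v: "\<phi> v = r u v"
    using uv r0 sym[of u v] by (auto simp: \<phi>_def)
  define \<sigma> where "\<sigma> x = \<tau> x - (\<Sum>z\<in>nbrs G x. (\<phi> x)\<^sup>2 - (\<phi> z)\<^sup>2) / D" for x
  have lap: "(\<Sum>z\<in>nbrs (add_edge G {u, v}) x. shortcut r u v x y - shortcut r u v z y) =
      \<sigma> x - (if x = y then 2 else 0)" if xy: "x \<in> verts G" "y \<in> verts G" for x y
  proof -
    have s: "shortcut r u v x y - shortcut r u v z y =
        (r x y - r z y) - ((\<phi> x)\<^sup>2 - (\<phi> z)\<^sup>2) / D + 2 * \<phi> y / D * (\<phi> x - \<phi> z)" for z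
      unfolding shortcut_def \<phi>_def[symmetric] D_def[symmetric]
      using D by (simp add: field_simps power2_eq_square)
    have L\<phi>: "(\<Sum>z\<in>nbrs G x. \<phi> x - \<phi> z) = (if x = v then 2 else 0) - (if x = u then 2 else 0)"
    proof -
      have "(\<Sum>z\<in>nbrs G x. \<phi> x - \<phi> z) =
          (\<Sum>z\<in>nbrs G x. r x u - r z u) - (\<Sum>z\<in>nbrs G x. r x v - r z v)"
        unfolding sum_subtractf[symmetric] by (intro sum.cong) (auto simp: \<phi>_def)
      then show ?thesis using \<tau>[OF xy(1) uv(1)] \<tau>[OF xy(1) uv(2)] by simp
    qed
    have old: "(\<Sum>z\<in>nbrs G x. shortcut r u v x y - shortcut r u v z y) =
        \<sigma> x - (if x = y then 2 else 0) +
        2 * \<phi> y / D * ((if x = v then 2 else 0) - (if x = u then 2 else 0))"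
      unfolding s sum.distrib sum_subtractf[of _ "\<lambda>z. ((\<phi> x)\<^sup>2 - (\<phi> z)\<^sup>2) / D"]
        sum_divide_distrib[symmetric] sum_distrib_left[symmetric] L\<phi> \<tau>[OF xy] \<sigma>_def
      by simp
    \<comment> \<open>The drop across the new edge must match the dipole strength in
      \<open>old\<close>; this fixes the denominator \<open>4 * (1 + r u v)\<close> of
      \<open>shortcut\<close>.\<close>
    have cross: "shortcut r u v u y - shortcut r u v v y = 4 * \<phi> y / D"
    proof -
      have "r u y - r v y = \<phi> y" using sym uv xy by (simp add: \<phi>_def)
      then have "(shortcut r u v u y - shortcut r u v v y) * D = \<phi> y * D - ((\<phi> u - \<phi> y)\<^sup>2 - (\<phi> v - \<phi> y)\<^sup>2)"
        unfolding shortcut_def \<phi>_def[symmetric] D_def[symmetric] using D by (simp add: field_simps)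
      also have "\<dots> = 4 * \<phi> y"
        unfolding \<phi>u \<phi>v D_def by (simp add: algebra_simps power2_eq_square)
      finally show ?thesis using D by (simp add: field_simps)
    qed
    show ?thesis
      unfolding sum_nbrs_add_edge[OF G uv] old using cross uv(3) by auto
  qed
  show ?thesis unfolding resistance_def
  proof (intro conjI exI ballI)
    show "walkable (add_edge G {u, v})" using G uv by (intro walkable_add_edge)
    show "shortcut r u v x x = 0" if "x \<in> verts (add_edge G {u, v})" for x
      using that r0 by (simp add: shortcut_def)
    show "shortcut r u v x y = shortcut r u v y x"
      if "x \<in> verts (add_edge G {u, v})" "y \<in> verts (add_edge G {u, v})" for x y
      using that sym[of x y] by (simp add: shortcut_def power2_commute)
  qed (use lap in auto)
qed

definition resistance_sum :: "'a sgraph \<Rightarrow> ('a \<Rightarrow> 'a \<Rightarrow> real) \<Rightarrow> 'a \<Rightarrow> real" where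
  "resistance_sum G r x = (\<Sum>y\<in>verts G. deg G y * r y x)"

text \<open>By \<open>kemeny_eq\<close> both constants are energies over volumes. The growth of the
  degrees of \<open>u\<close> and \<open>v\<close> gives the terms linear in \<open>r\<close>, the
  rank-one drop of the resistances gives the right-hand side, and the growth of the volume by 2
  gives \<open>2 * degree_energy G r / vol G\<close>.\<close>

lemma kemeny_add_edge_greater_iff:
  fixes r :: "'a \<Rightarrow> 'a \<Rightarrow> real"
  assumes r: "resistance G r" and uv: "u \<in> verts G" "v \<in> verts G" "u \<noteq> v" "{u, v} \<notin> edges G"
    and R: "1 + r u v > 0"
  defines "A \<equiv> resistance_sum G r"
  defines "Q \<equiv> \<Sum>x\<in>verts G. deg G x * (r x u - r x v)\<^sup>2"
  shows "kemeny (add_edge G {u, v}) > kemeny G \<longleftrightarrow>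
    2 * (A u + A v) + 2 * r u v - 2 * degree_energy G r / vol G >
    ((vol G + 2) * (Q + 2 * (r u v)\<^sup>2) - (A u - A v)\<^sup>2) / (2 * (1 + r u v))"
proof -
  define G' where "G' = add_edge G {u, v}"
  define \<phi> where "\<phi> x = r x u - r x v" for x
  have G: "walkable G" using r by (simp add: resistance_def)
  have sym: "r x y = r y x" if "x \<in> verts G" "y \<in> verts G" for x y
    using r that by (auto simp: resistance_def)
  have r0: "r x x = 0" if "x \<in> verts G" for x using r that by (auto simp: resistance_def)
  note sum_deg = sum_deg_add_edge[OF G uv, folded G'_def]
  have \<phi>u: "\<phi> u = - r u v" and \<phi>v: "\<phi> v = r u v"
    using uv r0 sym[of u v] by (auto simp: \<phi>_def)
  have V: "verts G' = verts G" by (simp add: G'_def)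
  have vol': "vol G' = vol G + 2" using sum_deg[of "\<lambda>_. 1"] by (simp add: V)
  have Q': "(\<Sum>x\<in>verts G. deg G' x * (\<phi> x)\<^sup>2) = Q + 2 * (r u v)\<^sup>2"
    unfolding sum_deg by (simp add: \<phi>u \<phi>v Q_def \<phi>_def[symmetric])
  have P': "(\<Sum>x\<in>verts G. deg G' x * \<phi> x) = A u - A v"
    unfolding sum_deg \<phi>u \<phi>v by (simp add: A_def resistance_sum_def \<phi>_def sum_subtractf right_diff_distrib)
  have "(\<Sum>x\<in>verts G. deg G' x * (\<Sum>y\<in>verts G. deg G' y * r x y)) =
      (\<Sum>x\<in>verts G. deg G' x * ((\<Sum>y\<in>verts G. deg G y * r x y) + r x u + r x v))"
    unfolding sum_deg ..
  also have "\<dots> = (\<Sum>x\<in>verts G. deg G x * (\<Sum>y\<in>verts G. deg G y * r x y)) + A u + A v +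
      (\<Sum>y\<in>verts G. deg G y * r u y) + (\<Sum>y\<in>verts G. deg G y * r v y) + 2 * r u v"
    unfolding sum_deg using uv r0 sym[of u v]
    by (simp add: distrib_left sum.distrib A_def resistance_sum_def)
  also have "(\<Sum>y\<in>verts G. deg G y * r u y) = A u"
    unfolding A_def resistance_sum_def using sym uv by (intro sum.cong) auto
  also have "(\<Sum>y\<in>verts G. deg G y * r v y) = A v"
    unfolding A_def resistance_sum_def using sym uv by (intro sum.cong) auto
  also have "(\<Sum>x\<in>verts G. deg G x * (\<Sum>y\<in>verts G. deg G y * r x y)) = degree_energy G r"
    by (simp add: degree_energy_def sum_distrib_left mult.assoc)
  finally have lin: "(\<Sum>x\<in>verts G. deg G' x * (\<Sum>y\<in>verts G. deg G' y * r x y)) =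
      degree_energy G r + 2 * (A u + A v) + 2 * r u v" by simp
  \<comment> \<open>Expanding the square leaves the weighted moments of \<phi> of orders 0, 1 and 2,
    so the double sum in \<open>quad\<close> is a variance up to normalisation.\<close>
  have inner: "(\<Sum>y\<in>verts G. deg G' y * (\<phi> x - \<phi> y)\<^sup>2) =
      (\<phi> x)\<^sup>2 * (vol G + 2) - 2 * \<phi> x * (A u - A v) + (Q + 2 * (r u v)\<^sup>2)" for x
    unfolding Q'[symmetric] P'[symmetric] vol'[symmetric] V
    by (simp add: power2_diff algebra_simps sum.distrib sum_subtractf sum_distrib_left)
  have quad: "(\<Sum>x\<in>verts G. deg G' x * (\<Sum>y\<in>verts G. deg G' y * (\<phi> x - \<phi> y)\<^sup>2)) =
      2 * ((vol G + 2) * (Q + 2 * (r u v)\<^sup>2) - (A u - A v)\<^sup>2)"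
  proof -
    have "(\<Sum>x\<in>verts G. deg G' x * (\<Sum>y\<in>verts G. deg G' y * (\<phi> x - \<phi> y)\<^sup>2)) =
      (\<Sum>x\<in>verts G. (vol G + 2) * (deg G' x * (\<phi> x)\<^sup>2) - 2 * (A u - A v) * (deg G' x * \<phi> x) +
        (Q + 2 * (r u v)\<^sup>2) * deg G' x)"
      unfolding inner by (intro sum.cong) (auto simp: algebra_simps)
    also have "\<dots> = (vol G + 2) * (Q + 2 * (r u v)\<^sup>2) - 2 * (A u - A v) * (A u - A v) +
        (Q + 2 * (r u v)\<^sup>2) * (vol G + 2)"
      unfolding sum.distrib sum_subtractf sum_distrib_left[symmetric] Q' P' vol'[unfolded V] ..
    finally show ?thesis by (simp add: power2_eq_square)
  qed
  have "degree_energy G' (shortcut r u v) =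
      (\<Sum>x\<in>verts G. deg G' x * (\<Sum>y\<in>verts G. deg G' y * r x y)) -
      (\<Sum>x\<in>verts G. deg G' x * (\<Sum>y\<in>verts G. deg G' y * (\<phi> x - \<phi> y)\<^sup>2)) / (4 * (1 + r u v))"
    unfolding degree_energy_def shortcut_def \<phi>_def[symmetric] V
    by (simp add: right_diff_distrib sum_subtractf sum_distrib_left sum_divide_distrib mult.assoc)
  also have "\<dots> = degree_energy G r + 2 * (A u + A v) + 2 * r u v -
      ((vol G + 2) * (Q + 2 * (r u v)\<^sup>2) - (A u - A v)\<^sup>2) / (2 * (1 + r u v))"
    unfolding lin quad using R by (simp add: field_simps)
  finally have E: "degree_energy G' (shortcut r u v) = degree_energy G r + (2 * (A u + A v) + 2 * r u v) -
      ((vol G + 2) * (Q + 2 * (r u v)\<^sup>2) - (A u - A v)\<^sup>2) / (2 * (1 + r u v))" by simp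
  have k: "kemeny G = degree_energy G r / (2 * vol G)" by (rule kemeny_eq[OF r])
  have k': "kemeny G' = degree_energy G' (shortcut r u v) / (2 * (vol G + 2))"
    using kemeny_eq[OF resistance_shortcut[OF r uv R]] vol' by (simp add: G'_def)
  have half: "s / (2 * t) = s / t / 2" for s t :: real by simp
  have V0: "vol G > 0" using G by (rule vol_pos)
  have "kemeny G' > kemeny G \<longleftrightarrow> degree_energy G r / vol G < degree_energy G' (shortcut r u v) / (vol G + 2)"
    unfolding k k' half by (subst divide_less_cancel) simp
  also have "\<dots> \<longleftrightarrow> degree_energy G r / vol G * (vol G + 2) < degree_energy G' (shortcut r u v)"
    using V0 by (intro pos_less_divide_eq) simp
  also have "degree_energy G r / vol G * (vol G + 2) = degree_energy G r + 2 * degree_energy G r / vol G"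
    using V0 by (simp add: distrib_left)
  finally have "kemeny G' > kemeny G \<longleftrightarrow>
      degree_energy G' (shortcut r u v) > degree_energy G r + 2 * degree_energy G r / vol G" .
  then show ?thesis unfolding E unfolding G'_def by argo
qed

section \<open>Resistances in spiders\<close>

text \<open>Graph distance in the coordinates of \<open>leg_vertex\<close>. The centre lies formally
  on leg 0, but at depth 0 both branches agree.\<close>

definition spider_dist :: "nat \<times> nat \<Rightarrow> nat \<times> nat \<Rightarrow> real" where
  "spider_dist x y =
    (if fst x = fst y then \<bar>real (snd x) - real (snd y)\<bar> else real (snd x) + real (snd y))"

lemma spider_dist_leg:
  "spider_dist (leg_vertex i k) (leg_vertex j l) = (if i = j then \<bar>real k - real l\<bar> else real k + real l)"
  by (auto simp: spider_dist_def leg_vertex_def)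

lemma leg_vertex_eq_iff [simp]:
  "leg_vertex i k = leg_vertex j l \<longleftrightarrow> k = l \<and> (k = 0 \<or> i = j)"
  by (auto simp: leg_vertex_def)

lemma leg_vertex_0: "leg_vertex i 0 = leg_vertex 0 0"
  by simp

lemma verts_spider: "verts (spider a b) = {leg_vertex i k | i k. i < b \<and> k \<le> a}"
  by (simp add: spider_def)

lemma leg_vertex_in_spider: "i < b \<Longrightarrow> k \<le> a \<Longrightarrow> leg_vertex i k \<in> verts (spider a b)"
  by (auto simp: verts_spider)

lemma spider_edge_iff:
  assumes "i < b" "k \<le> a" "j < b" "l \<le> a"
  shows "{leg_vertex i k, leg_vertex j l} \<in> edges (spider a b) \<longleftrightarrow>
    (l = Suc k \<and> (k = 0 \<or> i = j)) \<or> (k = Suc l \<and> (l = 0 \<or> i = j))"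
  using assms
  by (auto simp: spider_def doubleton_eq_iff)
    (rule exI[of _ j], rule exI[of _ k], simp, rule exI[of _ j], rule exI[of _ l], simp)

lemma nbrs_spider_center:
  assumes "a \<ge> 1"
  shows "nbrs (spider a b) (leg_vertex 0 0) = (\<lambda>i. leg_vertex i 1) ` {..<b}"
  using assms by (auto simp: nbrs_def spider_def doubleton_eq_iff image_iff)

lemma nbrs_spider_leg:
  assumes "i < b" "k < a"
  shows "nbrs (spider a b) (leg_vertex i (Suc k)) =
    insert (leg_vertex i k) (if Suc k < a then {leg_vertex i (Suc (Suc k))} else {})"
  using assms by (auto simp: nbrs_def spider_def doubleton_eq_iff image_iff)

lemma inj_leg_vertex_1: "inj_on (\<lambda>i. leg_vertex i 1) A"
  by (auto simp: inj_on_def)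

lemma verts_spider_split:
  assumes "b \<ge> 1"
  shows "verts (spider a b) =
    insert (leg_vertex 0 0) ((\<lambda>(i, k). leg_vertex i (Suc k)) ` ({..<b} \<times> {..<a}))"
proof (intro equalityI subsetI)
  fix x assume "x \<in> verts (spider a b)"
  then obtain i k where x: "x = leg_vertex i k" "i < b" "k \<le> a" by (auto simp: verts_spider)
  show "x \<in> insert (leg_vertex 0 0) ((\<lambda>(i, k). leg_vertex i (Suc k)) ` ({..<b} \<times> {..<a}))"
  proof (cases k)
    case (Suc k')
    then show ?thesis using x by (auto simp: image_iff)
  qed (use x in simp)
next
  fix x assume "x \<in> insert (leg_vertex 0 0) ((\<lambda>(i, k). leg_vertex i (Suc k)) ` ({..<b} \<times> {..<a}))"
  then show "x \<in> verts (spider a b)"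
    using assms leg_vertex_in_spider[of 0 b 0 a] by (auto intro: leg_vertex_in_spider)
qed

lemma walkable_spider:
  assumes "a \<ge> 1" "b \<ge> 1"
  shows "walkable (spider a b)"
proof -
  have "nbrs (spider a b) x \<noteq> {}" if "x \<in> verts (spider a b)" for x
    using that assms unfolding verts_spider_split[OF assms(2)]
    by (auto simp: nbrs_spider_leg nbrs_spider_center lessThan_empty_iff simp del: One_nat_def)
  then show ?thesis by (auto simp: walkable_def verts_spider_split[OF assms(2)])
qed

lemma sum_nbrs_spider_center:
  assumes "a \<ge> 1"
  shows "(\<Sum>z\<in>nbrs (spider a b) (leg_vertex 0 0). f z) = (\<Sum>i<b. f (leg_vertex i 1) :: real)"
  unfolding nbrs_spider_center[OF assms] by (subst sum.reindex[OF inj_leg_vertex_1]) simp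

lemma sum_nbrs_spider_leg:
  assumes "i < b" "k < a"
  shows "(\<Sum>z\<in>nbrs (spider a b) (leg_vertex i (Suc k)). f z) =
    f (leg_vertex i k) + (if Suc k < a then f (leg_vertex i (Suc (Suc k))) else 0 :: real)"
  unfolding nbrs_spider_leg[OF assms] by simp

lemma deg_spider:
  assumes "a \<ge> 1"
  shows "deg (spider a b) (leg_vertex 0 0) = real b"
    and "i < b \<Longrightarrow> k < a \<Longrightarrow> deg (spider a b) (leg_vertex i (Suc k)) = (if Suc k < a then 2 else 1)"
  using sum_nbrs_spider_center[OF assms, of "\<lambda>_. 1" b] sum_nbrs_spider_leg[of i b k a "\<lambda>_. 1"] by auto

text \<open>Double counting of incidences: \<open>f\<close> is added over both ends of every edge.
  This turns degree-weighted sums into sums over legs.\<close>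

lemma sum_deg_spider:
  assumes a: "a \<ge> 1" and b: "b \<ge> 1"
  shows "(\<Sum>x\<in>verts (spider a b). deg (spider a b) x * f x) =
    (\<Sum>i<b. \<Sum>k<a. f (leg_vertex i k) + f (leg_vertex i (Suc k)))"
proof -
  have leg: "(\<Sum>k<a. (if Suc k < a then 2 else 1) * f (leg_vertex i (Suc k))) + f (leg_vertex 0 0) =
      (\<Sum>k<a. f (leg_vertex i k) + f (leg_vertex i (Suc k)))" for i
  proof -
    obtain a' where a': "a = Suc a'" using a by (cases a) auto
    have "(\<Sum>k<a. (if Suc k < a then 2 else 1) * f (leg_vertex i (Suc k))) =
        2 * (\<Sum>k<a'. f (leg_vertex i (Suc k))) + f (leg_vertex i (Suc a'))"
      unfolding a' by (simp add: sum_distrib_left)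
    moreover have "(\<Sum>k<a. f (leg_vertex i k)) = f (leg_vertex 0 0) + (\<Sum>k<a'. f (leg_vertex i (Suc k)))"
      unfolding a' sum.lessThan_Suc_shift leg_vertex_0[of i] ..
    ultimately show ?thesis by (simp add: sum.distrib a')
  qed
  have inj: "inj_on (\<lambda>(i, k). leg_vertex i (Suc k)) ({..<b} \<times> {..<a})"
    by (auto simp: inj_on_def)
  have "(\<Sum>x\<in>verts (spider a b). deg (spider a b) x * f x) =
    real b * f (leg_vertex 0 0) + (\<Sum>i<b. \<Sum>k<a. deg (spider a b) (leg_vertex i (Suc k)) * f (leg_vertex i (Suc k)))"
    unfolding verts_spider_split[OF b]
    by (subst sum.insert) (auto simp: sum.reindex[OF inj] sum.cartesian_product deg_spider[OF a] intro!: sum.cong)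
  also have "\<dots> = (\<Sum>i<b. (\<Sum>k<a. (if Suc k < a then 2 else 1) * f (leg_vertex i (Suc k))) + f (leg_vertex 0 0))"
    by (simp add: sum.distrib deg_spider(2)[OF a])
  finally show ?thesis unfolding leg .
qed

text \<open>In a tree, unless \<open>x = y\<close>, exactly one neighbour of \<open>x\<close> is
  nearer to \<open>y\<close> by 1 and all others are farther by 1. Hence \<tau> is
  \<open>2 - deg\<close>.\<close>

lemma resistance_spider:
  assumes a: "a \<ge> 1" and b: "b \<ge> 1"
  shows "resistance (spider a b) spider_dist"
proof -
  let ?G = "spider a b"
  have lap: "(\<Sum>z\<in>nbrs ?G x. spider_dist x y - spider_dist z y) = (2 - deg ?G x) - (if x = y then 2 else 0)"
    if x: "x \<in> verts ?G" and y: "y \<in> verts ?G" for x y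
  proof -
    obtain j l where j: "y = leg_vertex j l" "j < b" "l \<le> a" using y by (auto simp: verts_spider)
    consider "x = leg_vertex 0 0" | i k where "x = leg_vertex i (Suc k)" "i < b" "k < a"
      using x unfolding verts_spider_split[OF b] by auto
    then show ?thesis
    proof cases
      case 1
      have c: "spider_dist (leg_vertex 0 0) y = real l"
        using j by (simp add: spider_dist_leg)
      have "(\<Sum>i<b. spider_dist (leg_vertex 0 0) y - spider_dist (leg_vertex i 1) y) =
          (\<Sum>i<b. (if i = j then (if l = 0 then 0 else 2) else 0) - 1)"
        unfolding c by (intro sum.cong refl) (auto simp: j(1) spider_dist_leg)
      also have "\<dots> = (if l = 0 then 0 else 2) - real b"
        using j(2) by (simp add: sum_subtractf)
      finally show ?thesis unfolding 1 sum_nbrs_spider_center[OF a] deg_spider(1)[OF a] j(1) by simp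
    next
      case 2
      \<comment> \<open>The depth of \<open>y\<close> is smaller than, equal to or larger than that
        of \<open>x\<close>; this resolves the absolute values.\<close>
      have "real l \<le> real k \<or> l = Suc k \<or> real l \<ge> real k + 2" by linarith
      then show ?thesis
        unfolding 2(1) sum_nbrs_spider_leg[OF 2(2,3)] deg_spider(2)[OF a 2(2,3)] j(1)
        using j(3) 2(3) by (auto simp: spider_dist_leg)
    qed
  qed
  show ?thesis unfolding resistance_def
  proof (intro conjI exI ballI)
    show "walkable ?G" using a b by (rule walkable_spider)
  qed (use lap in \<open>auto simp: spider_dist_def\<close>)
qed

lemma vol_spider:
  assumes "a \<ge> 1" "b \<ge> 1"
  shows "vol (spider a b) = 2 * real a * real b"
  using sum_deg_spider[OF assms, of "\<lambda>_. 1"] by simp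

section \<open>Polynomial inequalities\<close>

text \<open>
  For vertices on different legs at depths \<open>p\<close> and \<open>q\<close>, put \<open>d = p - q\<close> and \<open>R = p + q\<close>. Cleared of
  denominators, the Braess condition is \<open>(b - 2) a \<cdot> slope + offset < 0\<close>.
\<close>

definition cross_slope :: "real \<Rightarrow> real \<Rightarrow> real \<Rightarrow> real" where
  "cross_slope a d R = R\<^sup>2 * (4 * a - 2 * R) + 2 / 3 * R * (R + 1) * (R + 2) +
     2 * d\<^sup>2 * (2 * a + 1 - 2 * R) - 4 * R * (R + 1)"

definition cross_offset :: "real \<Rightarrow> real \<Rightarrow> real \<Rightarrow> real" where
  "cross_offset a d R = (2 * a + 1) * (R\<^sup>2 * (4 * a - 2 * R) + 2 / 3 * R * (R + 1) * (R + 2)) -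
     2 * R\<^sup>2 * d\<^sup>2 -
     (R + 1) * (2 * R\<^sup>2 + 2 * d\<^sup>2 + 2 * R + 2 + 8 / 3 * (a\<^sup>2 - 1))"

text \<open>Writing \<open>p = 1 + x\<close>, \<open>q = p + y\<close>, \<open>a = q + z\<close>
  turns the constraints into nonnegativity. The offset then has only nonnegative coefficients. The
  slope has two negative terms, absorbed because \<open>a \<ge> 2\<close> makes one of
  \<open>x\<close>, \<open>y\<close>, \<open>z\<close> at least 1.\<close>

lemma
  fixes p q a :: nat
  assumes "1 \<le> p" "p \<le> q" "q \<le> a" "2 \<le> a"
  shows cross_slope_nonneg: "0 \<le> cross_slope (real a) (real p - real q) (real (p + q))"
    and cross_offset_nonneg: "0 \<le> cross_offset (real a) (real p - real q) (real (p + q))"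
proof -
  obtain x where p: "p = Suc x" using assms(1) by (cases p) auto
  obtain y where q: "q = p + y" using assms(2) le_Suc_ex by blast
  obtain z where a: "a = q + z" using assms(3) le_Suc_ex by blast
  have xyz: "real x \<ge> 1 \<or> real y \<ge> 1 \<or> real z \<ge> 1" using assms(4) p q a by auto
  define X Y Z where "X = real x" and "Y = real y" and "Z = real z"
  have nn: "X \<ge> 0" "Y \<ge> 0" "Z \<ge> 0" by (auto simp: X_def Y_def Z_def)
  have sub: "real a = 1 + X + Y + Z" "real p - real q = - Y" "real (p + q) = 2 + 2 * X + Y"
    by (auto simp: p q a X_def Y_def Z_def)
  have "3 * cross_slope (real a) (real p - real q) (real (p + q)) =
      (16 * X ^ 3 + 24 * X\<^sup>2 + 16 * Y + 48 * Z + 24 * Y\<^sup>2 - 16 * X - 24) + 48 * Y * Z + 72 * Y * X + 96 * Z * X +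
      8 * Y ^ 3 + 24 * Y\<^sup>2 * Z + 24 * Y\<^sup>2 * X + 48 * Y * Z * X + 48 * Y * X\<^sup>2 + 48 * Z * X\<^sup>2"
    unfolding sub cross_slope_def
    by (simp add: algebra_simps power2_eq_square power3_eq_cube add_divide_distrib)
  moreover have "16 * X ^ 3 + 24 * X\<^sup>2 + 16 * Y + 48 * Z + 24 * Y\<^sup>2 + 72 * Y * X + 96 * Z * X - 16 * X - 24 \<ge> 0"
  proof -
    consider "X \<ge> 1" | "Y \<ge> 1" | "Z \<ge> 1" using xyz by (auto simp: X_def Y_def Z_def)
    then show ?thesis
    proof cases
      case 1
      then have "X ^ 3 \<ge> 1" "X\<^sup>2 \<ge> X" by (auto simp: self_le_power)
      moreover have "Y * X \<ge> 0" "Z * X \<ge> 0" "Y\<^sup>2 \<ge> 0" using nn by auto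
      ultimately show ?thesis using nn 1 unfolding mult.assoc by linarith
    next
      case 2
      then have "Y * X \<ge> 1 * X" using nn by (intro mult_right_mono) auto
      moreover have "Z * X \<ge> 0" "Y\<^sup>2 \<ge> 1" "X ^ 3 \<ge> 0" "X\<^sup>2 \<ge> 0" using nn 2 by auto
      ultimately show ?thesis using nn 2 unfolding mult.assoc by linarith
    next
      case 3
      then have "Z * X \<ge> 1 * X" using nn by (intro mult_right_mono) auto
      moreover have "Y * X \<ge> 0" "Y\<^sup>2 \<ge> 0" "X ^ 3 \<ge> 0" "X\<^sup>2 \<ge> 0" using nn by auto
      ultimately show ?thesis using nn 3 unfolding mult.assoc by linarith
    qed
  qed
  moreover have "48 * Y * Z + 8 * Y ^ 3 + 24 * Y\<^sup>2 * Z + 24 * Y\<^sup>2 * X + 48 * Y * Z * X + 48 * Y * X\<^sup>2 + 48 * Z * X\<^sup>2 \<ge> 0"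
    using nn by simp
  ultimately show "0 \<le> cross_slope (real a) (real p - real q) (real (p + q))" by linarith
  have "3 * cross_offset (real a) (real p - real q) (real (p + q)) =
      18 + 96 * X + 144 * Y + 192 * Z + 176 * X\<^sup>2 + 432 * X * Y + 512 * X * Z + 148 * Y\<^sup>2
      + 328 * Y * Z + 72 * Z\<^sup>2 + 128 * X ^ 3 + 416 * X\<^sup>2 * Y + 448 * X\<^sup>2 * Z + 304 * X * Y\<^sup>2
      + 624 * X * Y * Z + 176 * X * Z\<^sup>2 + 64 * Y ^ 3 + 200 * Y\<^sup>2 * Z + 88 * Y * Z\<^sup>2
      + 32 * X ^ 4 + 128 * X ^ 3 * Y + 128 * X ^ 3 * Z + 144 * X\<^sup>2 * Y\<^sup>2 + 288 * X\<^sup>2 * Y * Z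
      + 96 * X\<^sup>2 * Z\<^sup>2 + 64 * X * Y ^ 3 + 192 * X * Y\<^sup>2 * Z + 96 * X * Y * Z\<^sup>2
      + 10 * Y ^ 4 + 40 * Y ^ 3 * Z + 24 * Y\<^sup>2 * Z\<^sup>2"
    unfolding sub cross_offset_def
    by (simp add: algebra_simps power2_eq_square power3_eq_cube power4_eq_xxxx add_divide_distrib)
  moreover have "\<dots> \<ge> 0" using nn by simp
  ultimately show "0 \<le> cross_offset (real a) (real p - real q) (real (p + q))" by linarith
qed

text \<open>
  For vertices on one leg at distance \<open>R\<close>, the outer one at distance \<open>c\<close> from the leaf, the gain is the
  increase of Kemeny's constant up to a positive factor; \<open>m\<close> is the number of edges.
\<close>

definition braess_excess :: "real \<Rightarrow> real \<Rightarrow> real \<Rightarrow> real" where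
  "braess_excess a c R = c * (R\<^sup>2 + R + 1) / (R + 1) + R * (R + 2) / 3 - a"

definition braess_gain :: "real \<Rightarrow> real \<Rightarrow> real \<Rightarrow> real \<Rightarrow> real" where
  "braess_gain m a c R = - (m * braess_excess a c R) - 2 / 3 * a\<^sup>2 +
     (c + R) * (c * (R\<^sup>2 + R + 1) / (R + 1)) + (R + 1)\<^sup>2 * (3 * R - 1) / 12"

text \<open>Makes the last summand of \<open>braess_gain\<close> comparable with monomials that the
  estimates below can absorb.\<close>

lemma cube_tail: fixes R :: real assumes "R \<ge> 2"
  shows "(R + 1)\<^sup>2 * (3 * R - 1) / 12 \<le> R ^ 3 / 3 + R\<^sup>2 / 3"
proof -
  have "R ^ 3 / 3 + R\<^sup>2 / 3 - (R + 1)\<^sup>2 * (3 * R - 1) / 12 = (R * (R * (R - 2) + (R - 2)) + R + 1) / 12"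
    by (simp add: field_simps power2_eq_square power3_eq_cube)
  moreover have "\<dots> \<ge> 0" using assms by simp
  ultimately show ?thesis by linarith
qed

text \<open>For nonnegative excess the gain does not increase with \<open>m\<close>, so smaller
  multiples of \<open>a\<close> may replace \<open>m\<close>. If
  \<open>3 * (c + R) \<le> 2 * a\<close>, the multiple \<open>2 / 3 * a\<close> suffices; otherwise
  the full \<open>2 * a\<close> is spent, the case of two legs.\<close>

lemma braess_gain_nonpos:
  fixes m a c R :: real
  assumes R: "R \<ge> 2" and c: "c \<ge> 0" "c + R \<le> a" and m: "2 * a \<le> m" and E: "braess_excess a c R \<ge> 0"
  shows "braess_gain m a c R \<le> 0"
proof -
  define s where "s = c + R"
  define K where "K = c * (R\<^sup>2 + R + 1) / (R + 1)"
  define T where "T = (R + 1)\<^sup>2 * (3 * R - 1) / 12"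
  define e where "e = K + R * (R + 2) / 3 - a"
  have s: "0 < s" "s \<le> a" using R c by (auto simp: s_def)
  have e: "e \<ge> 0" using E by (simp add: e_def K_def braess_excess_def)
  \<comment> \<open>This says \<open>K = R * c + c / (R + 1)\<close>.\<close>
  have "K * (R + 1) = c * (R\<^sup>2 + R + 1)" using R by (simp add: K_def)
  then have "(K - R * c) * (R + 1) = c" by (simp add: algebra_simps power2_eq_square)
  then have K: "R * c \<le> K" using R c by (smt (verit) mult_nonpos_nonneg zero_le_mult_iff)
  have K0: "0 \<le> K" using K R c by (smt (verit) mult_nonneg_nonneg)
  have T: "T \<le> R ^ 3 / 3 + R\<^sup>2 / 3" using cube_tail[OF R] by (simp add: T_def)
  have gain: "braess_gain m a c R = - (m * e) - 2 / 3 * a\<^sup>2 + s * K + T"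
    by (simp add: braess_gain_def braess_excess_def e_def K_def T_def s_def)
  show ?thesis
  proof (cases "3 * s \<le> 2 * a")
    case True
    \<comment> \<open>The factor \<open>2 / 3 * a\<close> makes the terms in
      \<open>a\<^sup>2\<close> cancel and gives \<open>K\<close> the nonpositive coefficient
      \<open>s - 2 / 3 * a\<close>.\<close>
    have "2 / 3 * a * e \<le> m * e" using e s m by (intro mult_right_mono) auto
    then have "braess_gain m a c R \<le> - (2 / 3 * a * e) - 2 / 3 * a\<^sup>2 + s * K + T" using gain by simp
    also have "\<dots> = (s - 2 / 3 * a) * K - 2 / 9 * a * R * (R + 2) + T"
      by (simp add: e_def algebra_simps power2_eq_square)
    also have "\<dots> \<le> - 2 / 9 * a * R * (R + 2) + T"
      using True K0 by (simp add: mult_nonpos_nonneg)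
    \<comment> \<open>Since \<open>R \<le> s\<close> and \<open>3 * s \<le> 2 * a\<close>,
      \<open>a\<close> is at least \<open>3 / 2 * R\<close>.\<close>
    also have "\<dots> \<le> - 2 / 9 * (3 / 2 * R) * R * (R + 2) + T"
    proof -
      have "3 / 2 * R * (R * (R + 2)) \<le> a * (R * (R + 2))"
        using True R c by (intro mult_right_mono) (auto simp: s_def)
      then show ?thesis by simp
    qed
    also have "\<dots> \<le> 0"
    proof -
      have "- 2 / 9 * (3 / 2 * R) * R * (R + 2) + T = T - R ^ 3 / 3 - 2 / 3 * R\<^sup>2"
        by (simp add: algebra_simps power2_eq_square power3_eq_cube)
      then show ?thesis using T zero_le_power2[of R] by linarith
    qed
    finally show ?thesis .
  next
    case False
    define p where "p = a - s"
    have p: "0 \<le> p" "p \<le> s / 2" using s False by (auto simp: p_def)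
    have a: "a = s + p" by (simp add: p_def)
    have "2 * a * e \<le> m * e" using e m by (intro mult_right_mono) auto
    then have "braess_gain m a c R \<le> - (2 * a * e) - 2 / 3 * a\<^sup>2 + s * K + T" using gain by simp
    also have "\<dots> = - (s + 2 * p) * K - 2 / 3 * (s + p) * (R * (R + 2)) + 4 / 3 * (s + p)\<^sup>2 + T"
      by (simp add: e_def a algebra_simps power2_eq_square)
    also have "\<dots> \<le> - (s + 2 * p) * (R * c) - 2 / 3 * (s + p) * (R * (R + 2)) + 4 / 3 * (s + p)\<^sup>2 + T"
    proof -
      have "(s + 2 * p) * (R * c) \<le> (s + 2 * p) * K" using K s p by (intro mult_left_mono) auto
      then show ?thesis by (simp add: algebra_simps)
    qed
    also have "\<dots> \<le> 0"
    proof -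
      \<comment> \<open>\<open>p\<^sup>2 \<le> p s / 2\<close> makes the bound linear in \<open>p\<close>, so that only \<open>p = 0\<close> and \<open>p = s / 2\<close> matter.\<close>
      define L where "L x = - (s + 2 * x) * (R * c) - 2 / 3 * (s + x) * (R * (R + 2)) + 4 / 3 * (s\<^sup>2 + 5 / 2 * s * x) + T" for x
      \<comment> \<open>At both endpoints the parts in \<open>c\<^sup>2\<close>, in \<open>c\<close>
        and in pure powers of \<open>R\<close> are each nonpositive for
        \<open>R \<ge> 2\<close>.\<close>
      have L0: "L 0 \<le> 0"
      proof -
        have "L 0 = - (R * c\<^sup>2 - 4 / 3 * c\<^sup>2) - (5 / 3 * R\<^sup>2 * c - 4 / 3 * R * c) - 2 / 3 * R ^ 3 + T"
          by (simp add: L_def s_def field_simps power2_eq_square power3_eq_cube)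
        moreover have "4 / 3 * c\<^sup>2 \<le> R * c\<^sup>2" using R by (intro mult_right_mono) auto
        moreover have "4 / 3 * (R * c) \<le> 5 / 3 * R * (R * c)" using R c by (intro mult_right_mono) auto
        moreover have "R\<^sup>2 \<le> R ^ 3" using R by (simp add: power_increasing)
        ultimately show ?thesis using T by (simp add: power2_eq_square power3_eq_cube)
      qed
      have L1: "L (s / 2) \<le> 0"
      proof -
        have "L (s / 2) = - (2 * R * c\<^sup>2 - 3 * c\<^sup>2) - (3 * R\<^sup>2 * c - 4 * R * c) - R ^ 3 + R\<^sup>2 + T"
          by (simp add: L_def s_def field_simps power2_eq_square power3_eq_cube)
        moreover have "3 * c\<^sup>2 \<le> 2 * R * c\<^sup>2" using R by (intro mult_right_mono) auto
        moreover have "4 * (R * c) \<le> 3 * R * (R * c)" using R c by (intro mult_right_mono) auto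
        moreover have "2 * R\<^sup>2 \<le> R * R\<^sup>2" using R by (intro mult_right_mono) auto
        ultimately show ?thesis using T by (simp add: power2_eq_square power3_eq_cube)
      qed
      have "p * p \<le> p * (s / 2)" using p by (intro mult_left_mono) auto
      then have "- (s + 2 * p) * (R * c) - 2 / 3 * (s + p) * (R * (R + 2)) + 4 / 3 * (s + p)\<^sup>2 + T \<le> L p"
        by (simp add: L_def algebra_simps power2_eq_square)
      moreover have "L p \<le> 0"
      proof -
        \<comment> \<open>\<open>L\<close> is affine, so \<open>L p\<close> is a convex combination
          of its values at 0 and \<open>s / 2\<close>.\<close>
        have "s * L p = (s - 2 * p) * L 0 + 2 * p * L (s / 2)"
          by (simp add: L_def algebra_simps power2_eq_square add_divide_distrib diff_divide_distrib)
        also have "\<dots> \<le> 0"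
          using p L0 L1 by (intro add_nonpos_nonpos mult_nonneg_nonpos) auto
        finally show ?thesis using s by (simp add: mult_le_0_iff)
      qed
      ultimately show ?thesis by linarith
    qed
    finally show ?thesis .
  qed
qed

section \<open>Braess edges of spiders\<close>

lemma sum_lessThan_add:
  fixes f :: "nat \<Rightarrow> 'a :: comm_monoid_add"
  shows "(\<Sum>k<m + n. f k) = (\<Sum>k<m. f k) + (\<Sum>k<n. f (m + k))"
  by (induction n) (simp_all add: add.assoc)

lemma sum_abs_diff_consecutive:
  "(\<Sum>k<p + c. \<bar>real k - real p\<bar> + \<bar>real (Suc k) - real p\<bar>) = (real p)\<^sup>2 + (real c)\<^sup>2"
proof -
  have "(\<Sum>k<p. \<bar>real k - real p\<bar> + \<bar>real (Suc k) - real p\<bar>) = (\<Sum>k<p. 2 * real p - 2 * real k - 1)"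
    by (intro sum.cong) auto
  also have "\<dots> = (real p)\<^sup>2"
  proof -
    have "(\<Sum>k<n. 2 * x - 2 * real k - 1) = 2 * real n * x - (real n)\<^sup>2" for n x
      by (induction n) (auto simp: algebra_simps power2_eq_square)
    from this[of "real p" p] show ?thesis by (simp add: power2_eq_square)
  qed
  moreover have "(\<Sum>k<c. \<bar>real (p + k) - real p\<bar> + \<bar>real (Suc (p + k)) - real p\<bar>) = (real c)\<^sup>2"
    by (induction c) (auto simp: algebra_simps power2_eq_square)
  ultimately show ?thesis unfolding sum_lessThan_add by simp
qed

lemma sum_linear_consecutive: "(\<Sum>k<n. (real k + x) + (real (Suc k) + x)) = (real n)\<^sup>2 + 2 * real n * x"
  by (induction n) (auto simp: algebra_simps power2_eq_square)

lemma sum_squares_consecutive: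
  "(\<Sum>k<n. (x - 2 * real k)\<^sup>2 + (x - 2 * real (Suc k))\<^sup>2) =
    2 * real n * x\<^sup>2 - 4 * x * (real n)\<^sup>2 + 4 / 3 * real n * (2 * (real n)\<^sup>2 + 1)"
  by (induction n) (auto simp: field_simps power2_eq_square)

lemma sum_over_legs:
  fixes f :: "nat \<Rightarrow> real"
  assumes "i < b" "\<And>j. j < b \<Longrightarrow> j \<noteq> i \<Longrightarrow> f j = y"
  shows "(\<Sum>j<b. f j) = f i + (real b - 1) * y"
proof -
  have "(\<Sum>j<b. f j) = f i + (\<Sum>j\<in>{..<b} - {i}. f j)" using assms(1) by (simp add: sum.remove)
  also have "(\<Sum>j\<in>{..<b} - {i}. f j) = (\<Sum>j\<in>{..<b} - {i}. y)" using assms(2) by (intro sum.cong) auto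
  finally show ?thesis using assms(1) by (simp add: of_nat_diff)
qed

section \<open>Distance sums and degree energy of a spider\<close>

lemma resistance_sum_spider:
  assumes a: "a \<ge> 1" and b: "b \<ge> 1" and i: "i < b" and p: "p \<le> a"
  shows "resistance_sum (spider a b) spider_dist (leg_vertex i p) =
    (real b - 1) * ((real a)\<^sup>2 + 2 * real a * real p) + (real p)\<^sup>2 + (real a - real p)\<^sup>2"
proof -
  define F where "F j = (\<Sum>k<a. spider_dist (leg_vertex j k) (leg_vertex i p) +
      spider_dist (leg_vertex j (Suc k)) (leg_vertex i p))" for j
  obtain c where c: "a = p + c" using p le_Suc_ex by blast
  have "F j = (real a)\<^sup>2 + 2 * real a * real p" if "j \<noteq> i" for j
    using that unfolding F_def spider_dist_leg by (simp add: sum_linear_consecutive[simplified])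
  moreover have "F i = (real p)\<^sup>2 + (real a - real p)\<^sup>2"
    using sum_abs_diff_consecutive[of p c] unfolding F_def spider_dist_leg by (simp add: c)
  ultimately show ?thesis
    using sum_over_legs[OF i, of F] unfolding resistance_sum_def sum_deg_spider[OF a b] F_def by simp
qed

lemma degree_energy_spider:
  assumes a: "a \<ge> 1" and b: "b \<ge> 1"
  shows "degree_energy (spider a b) spider_dist =
    real b * (4 * (real b - 1) * (real a) ^ 3 + 2 / 3 * (2 * (real a) ^ 3 + real a))"
proof -
  let ?G = "spider a b"
  let ?A = "resistance_sum ?G spider_dist"
  \<comment> \<open>\<open>x\<close> and \<open>y\<close> stand for \<open>b - 1\<close> and
    \<open>a\<close>; keeping them independent of \<open>n\<close> lets the induction go
    through.\<close>
  have poly: "(\<Sum>k<n. (x * (y\<^sup>2 + 2 * y * real k) + (real k)\<^sup>2 + (y - real k)\<^sup>2) +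
      (x * (y\<^sup>2 + 2 * y * real (Suc k)) + (real (Suc k))\<^sup>2 + (y - real (Suc k))\<^sup>2)) =
    2 * real n * x * y\<^sup>2 + 2 * x * y * (real n)\<^sup>2 + 2 / 3 * (2 * (real n) ^ 3 + real n) +
      2 * real n * y\<^sup>2 - 2 * y * (real n)\<^sup>2" for n x y
    by (induction n) (simp_all add: field_simps power2_eq_square power3_eq_cube)
  have "degree_energy ?G spider_dist = (\<Sum>x\<in>verts ?G. deg ?G x * ?A x)"
    unfolding degree_energy_def resistance_sum_def sum_distrib_left
    by (intro sum.cong) (auto simp: spider_dist_def)
  also have "\<dots> = (\<Sum>i<b. \<Sum>k<a. ?A (leg_vertex i k) + ?A (leg_vertex i (Suc k)))"
    by (rule sum_deg_spider[OF a b])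
  also have "\<dots> = (\<Sum>i<b. 4 * (real b - 1) * (real a) ^ 3 + 2 / 3 * (2 * (real a) ^ 3 + real a))"
  proof (rule sum.cong[OF refl])
    fix i assume "i \<in> {..<b}"
    then have "(\<Sum>k<a. ?A (leg_vertex i k) + ?A (leg_vertex i (Suc k))) =
      (\<Sum>k<a. ((real b - 1) * ((real a)\<^sup>2 + 2 * real a * real k) + (real k)\<^sup>2 + (real a - real k)\<^sup>2) +
        ((real b - 1) * ((real a)\<^sup>2 + 2 * real a * real (Suc k)) + (real (Suc k))\<^sup>2 + (real a - real (Suc k))\<^sup>2))"
      by (intro sum.cong refl) (simp add: resistance_sum_spider[OF a b])
    then show "(\<Sum>k<a. ?A (leg_vertex i k) + ?A (leg_vertex i (Suc k))) =
        4 * (real b - 1) * (real a) ^ 3 + 2 / 3 * (2 * (real a) ^ 3 + real a)"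
      unfolding poly by (simp add: power2_eq_square power3_eq_cube algebra_simps)
  qed
  finally show ?thesis by simp
qed

text \<open>Evaluates \<open>kemeny_add_edge_greater_iff\<close>: the difference of its two sides is
  exactly 8 times \<open>braess_gain\<close>.\<close>

lemma kemeny_spider_same_leg:
  assumes a: "a \<ge> 1" and b: "b \<ge> 1" and i: "i < b" and pq: "Suc p < q" "q \<le> a"
  shows "kemeny (add_edge (spider a b) {leg_vertex i p, leg_vertex i q}) > kemeny (spider a b) \<longleftrightarrow>
    braess_gain (real a * real b) (real a) (real (a - q)) (real (q - p)) > 0"
proof -
  let ?G = "spider a b"
  let ?u = "leg_vertex i p" and ?v = "leg_vertex i q"
  define n c where n_def: "n = q - p" and c_def: "c = a - q"
  then have n: "q = p + n" and c: "a = p + n + c" using pq by auto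
  have uv: "?u \<in> verts ?G" "?v \<in> verts ?G" using i pq by (auto intro!: leg_vertex_in_spider)
  have ne: "?u \<noteq> ?v" using pq by simp
  have nonedge: "{?u, ?v} \<notin> edges ?G" using i pq by (subst spider_edge_iff) auto
  have d: "spider_dist ?u ?v = real n" by (simp add: spider_dist_leg n)
  define \<psi> where "\<psi> x = (spider_dist x ?u - spider_dist x ?v)\<^sup>2" for x
  define F where "F j = (\<Sum>k<a. \<psi> (leg_vertex j k) + \<psi> (leg_vertex j (Suc k)))" for j
  have Fj: "F j = 2 * real a * (real n)\<^sup>2" if "j \<noteq> i" for j
    using that by (simp add: F_def \<psi>_def spider_dist_leg n)
  \<comment> \<open>On this leg the difference of distances is \<open>- n\<close> up to depth
    \<open>p\<close>, \<open>n\<close> from depth \<open>q\<close> on, and linear with slope 2 in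
    between; on the other legs it is \<open>- n\<close>.\<close>
  have "F i = (\<Sum>k<p. 2 * (real n)\<^sup>2) + (\<Sum>k<n. (real n - 2 * real k)\<^sup>2 + (real n - 2 * real (Suc k))\<^sup>2) +
      (\<Sum>k<c. 2 * (real n)\<^sup>2)"
    unfolding F_def c sum_lessThan_add \<psi>_def spider_dist_leg n
    by (intro arg_cong2[where f = "(+)"] sum.cong refl) (auto simp: power2_eq_square algebra_simps)
  then have Fi: "F i = 2 * (real p + real c) * (real n)\<^sup>2 + (2 * (real n) ^ 3 + 4 * real n) / 3"
    unfolding sum_squares_consecutive by (simp add: power2_eq_square power3_eq_cube field_simps)
  have Q: "(\<Sum>x\<in>verts ?G. deg ?G x * (spider_dist x ?u - spider_dist x ?v)\<^sup>2) =
      F i + (real b - 1) * (2 * real a * (real n)\<^sup>2)"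
    unfolding sum_deg_spider[OF a b] \<psi>_def[symmetric] F_def[symmetric]
    using i Fj by (rule sum_over_legs)
  have V: "degree_energy ?G spider_dist / vol ?G = 2 * (real b - 1) * (real a)\<^sup>2 + (2 * (real a)\<^sup>2 + 1) / 3"
    unfolding degree_energy_spider[OF a b] vol_spider[OF a b] using a b
    by (simp add: field_simps power2_eq_square power3_eq_cube)
  have pos: "1 + real n > 0" by simp
  have iff: "kemeny (add_edge ?G {?u, ?v}) > kemeny ?G \<longleftrightarrow>
      0 < 2 * (resistance_sum ?G spider_dist ?u + resistance_sum ?G spider_dist ?v) + 2 * real n -
        2 * (degree_energy ?G spider_dist / vol ?G) -
      ((vol ?G + 2) * (F i + (real b - 1) * (2 * real a * (real n)\<^sup>2) + 2 * (real n)\<^sup>2) -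
        (resistance_sum ?G spider_dist ?u - resistance_sum ?G spider_dist ?v)\<^sup>2) / (2 * (1 + real n))"
    using kemeny_add_edge_greater_iff[OF resistance_spider[OF a b] uv ne nonedge] unfolding d Q
    by auto
  have "2 * (resistance_sum ?G spider_dist ?u + resistance_sum ?G spider_dist ?v) + 2 * real n -
        2 * (degree_energy ?G spider_dist / vol ?G) -
      ((vol ?G + 2) * (F i + (real b - 1) * (2 * real a * (real n)\<^sup>2) + 2 * (real n)\<^sup>2) -
        (resistance_sum ?G spider_dist ?u - resistance_sum ?G spider_dist ?v)\<^sup>2) / (2 * (1 + real n))
      = 8 * braess_gain (real a * real b) (real a) (real c) (real n)"
  proof -
    have p: "real p = real a - real c - real n" using c by simp
    have q: "real q = real a - real c" using c n by simp
    have lin: "resistance_sum ?G spider_dist ?u + resistance_sum ?G spider_dist ?v =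
      (real b - 1) * (2 * (real a)\<^sup>2 + 2 * real a * (2 * (real a - real c) - real n)) +
      (real a - real c - real n)\<^sup>2 + (real c + real n)\<^sup>2 + (real a - real c)\<^sup>2 + (real c)\<^sup>2"
      using i pq by (simp add: resistance_sum_spider[OF a b] p q algebra_simps)
    have diff: "resistance_sum ?G spider_dist ?u - resistance_sum ?G spider_dist ?v =
      - (2 * real n * (real a * real b - real n - 2 * real c))"
      using i pq by (simp add: resistance_sum_spider[OF a b] p q algebra_simps power2_eq_square)
    have twelve: "x = y" if "12 * x = 12 * y" for x y :: real using that by simp
    have gain: "(1 + real n) * braess_gain (real a * real b) (real a) (real c) (real n) =
        (real c + real n - real a * real b) * (real c * ((real n)\<^sup>2 + real n + 1)) -
        (1 + real n) * (real a * real b * (real n * (real n + 2) / 3 - real a) + 2 / 3 * (real a)\<^sup>2 -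
          (real n + 1)\<^sup>2 * (3 * real n - 1) / 12)"
    proof -
      define K where "K = real c * ((real n)\<^sup>2 + real n + 1) / (real n + 1)"
      have K: "real c * ((real n)\<^sup>2 + real n + 1) = (1 + real n) * K"
        using pos unfolding K_def add.commute[of 1 "real n"] by simp
      show ?thesis
        unfolding braess_gain_def braess_excess_def K_def[symmetric] unfolding K
        by (rule twelve) (simp add: algebra_simps power2_eq_square)
    qed
    have clear: "x - y / (2 * z) = 8 * w" if "2 * z * x - y = 16 * (z * w)" "z > 0" for x y z w :: real
      using that by (simp add: field_simps)
    show ?thesis
      unfolding lin diff V unfolding vol_spider[OF a b] Fi p
      by (rule clear[OF _ pos], unfold gain, rule twelve)
        (simp add: algebra_simps power2_eq_square power3_eq_cube add_divide_distrib diff_divide_distrib)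
  qed
  then show ?thesis unfolding iff n_def c_def by simp
qed

section \<open>Pairs on different legs\<close>

lemma sum_two_exceptions:
  fixes f :: "nat \<Rightarrow> real"
  assumes "i < b" "j < b" "i \<noteq> j" "\<And>l. l < b \<Longrightarrow> l \<noteq> i \<Longrightarrow> l \<noteq> j \<Longrightarrow> f l = y"
  shows "(\<Sum>l<b. f l) = f i + f j + (real b - 2) * y"
proof -
  have "(\<Sum>l<b. f l) = (\<Sum>l<b. (if l = i then f i - y else 0) + (if l = j then f j - y else 0) + y)"
    using assms by (intro sum.cong) auto
  also have "\<dots> = f i + f j + (real b - 2) * y"
    using assms(1,2) by (simp add: sum.distrib algebra_simps)
  finally show ?thesis .
qed

text \<open>Cleared of denominators, the same criterion has left minus right side equal to
  \<open>- 2\<close> times the combination of slope and offset, both of which are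
  nonnegative.\<close>

lemma not_kemeny_spider_cross_legs:
  assumes a: "a \<ge> 2" and b: "b \<ge> 2" and ij: "i < b" "j < b" "i \<noteq> j" and pq: "1 \<le> p" "p \<le> q" "q \<le> a"
  shows "\<not> kemeny (add_edge (spider a b) {leg_vertex i p, leg_vertex j q}) > kemeny (spider a b)"
proof -
  let ?G = "spider a b"
  let ?u = "leg_vertex i p" and ?v = "leg_vertex j q"
  have a1: "a \<ge> 1" and b1: "b \<ge> 1" using a b by auto
  obtain c where c: "a = p + c" using pq le_Suc_ex by (metis le_trans)
  obtain e where e: "a = q + e" using pq le_Suc_ex by blast
  have uv: "?u \<in> verts ?G" "?v \<in> verts ?G" using ij pq by (auto intro!: leg_vertex_in_spider)
  have ne: "?u \<noteq> ?v" using pq ij by simp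
  have nonedge: "{?u, ?v} \<notin> edges ?G" using ij pq by (subst spider_edge_iff) auto
  have d: "spider_dist ?u ?v = real (p + q)" using ij by (simp add: spider_dist_leg)
  define \<psi> where "\<psi> x = (spider_dist x ?u - spider_dist x ?v)\<^sup>2" for x
  define F where "F l = (\<Sum>k<a. \<psi> (leg_vertex l k) + \<psi> (leg_vertex l (Suc k)))" for l
  define \<delta> where "\<delta> = real p - real q"
  have Fl: "F l = 2 * real a * \<delta>\<^sup>2" if "l \<noteq> i" "l \<noteq> j" for l
    using that by (simp add: F_def \<psi>_def spider_dist_leg \<delta>_def)
  \<comment> \<open>On leg \<open>i\<close> the difference of distances falls from \<delta> at the
    centre to \<open>- (p + q)\<close> at depth \<open>p\<close> and stays there. Leg
    \<open>j\<close> is the mirror image with \<open>- \<delta>\<close>; on all other legs the value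
    is \<delta>.\<close>
  have "F i = (\<Sum>k<p. (\<delta> - 2 * real k)\<^sup>2 + (\<delta> - 2 * real (Suc k))\<^sup>2) + (\<Sum>k<c. 2 * (real (p + q))\<^sup>2)"
    unfolding F_def c sum_lessThan_add \<psi>_def spider_dist_leg \<delta>_def using ij(3)
    by (intro arg_cong2[where f = "(+)"] sum.cong refl) (auto simp: power2_eq_square algebra_simps)
  then have Fi: "F i = 2 * real p * \<delta>\<^sup>2 - 4 * \<delta> * (real p)\<^sup>2 + 4 / 3 * real p * (2 * (real p)\<^sup>2 + 1) +
      2 * (real a - real p) * (real (p + q))\<^sup>2"
    unfolding sum_squares_consecutive by (simp add: c)
  have "F j = (\<Sum>k<q. (- \<delta> - 2 * real k)\<^sup>2 + (- \<delta> - 2 * real (Suc k))\<^sup>2) + (\<Sum>k<e. 2 * (real (p + q))\<^sup>2)"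
    unfolding F_def e sum_lessThan_add \<psi>_def spider_dist_leg \<delta>_def using ij(3)
    by (intro arg_cong2[where f = "(+)"] sum.cong refl) (auto simp: power2_eq_square algebra_simps)
  then have Fj: "F j = 2 * real q * \<delta>\<^sup>2 + 4 * \<delta> * (real q)\<^sup>2 + 4 / 3 * real q * (2 * (real q)\<^sup>2 + 1) +
      2 * (real a - real q) * (real (p + q))\<^sup>2"
    unfolding sum_squares_consecutive by (simp add: e)
  have Q: "(\<Sum>x\<in>verts ?G. deg ?G x * (spider_dist x ?u - spider_dist x ?v)\<^sup>2) =
      F i + F j + (real b - 2) * (2 * real a * \<delta>\<^sup>2)"
    unfolding sum_deg_spider[OF a1 b1] \<psi>_def[symmetric] F_def[symmetric]
    using ij Fl by (intro sum_two_exceptions) auto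
  have V: "degree_energy ?G spider_dist / vol ?G = 2 * (real b - 1) * (real a)\<^sup>2 + (2 * (real a)\<^sup>2 + 1) / 3"
    unfolding degree_energy_spider[OF a1 b1] vol_spider[OF a1 b1] using a b
    by (simp add: field_simps power2_eq_square power3_eq_cube)
  define R where "R = real p + real q"
  have pos: "1 + R > 0" by (simp add: R_def)
  have iff: "kemeny (add_edge ?G {?u, ?v}) > kemeny ?G \<longleftrightarrow>
      0 < 2 * (resistance_sum ?G spider_dist ?u + resistance_sum ?G spider_dist ?v) + 2 * R -
        2 * (degree_energy ?G spider_dist / vol ?G) -
      ((vol ?G + 2) * (F i + F j + (real b - 2) * (2 * real a * \<delta>\<^sup>2) + 2 * R\<^sup>2) -
        (resistance_sum ?G spider_dist ?u - resistance_sum ?G spider_dist ?v)\<^sup>2) / (2 * (1 + R))"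
    using kemeny_add_edge_greater_iff[OF resistance_spider[OF a1 b1] uv ne nonedge] pos
    unfolding d Q by (auto simp: R_def)
  \<comment> \<open>In \<open>R\<close> and \<delta>, exchanging the two vertices flips the sign of
    \<delta>, so odd powers of \<delta> drop out.\<close>
  have p: "real p = (R + \<delta>) / 2" and q: "real q = (R - \<delta>) / 2" by (auto simp: R_def \<delta>_def)
  have lin: "resistance_sum ?G spider_dist ?u + resistance_sum ?G spider_dist ?v =
    (real b - 1) * (2 * (real a)\<^sup>2 + 2 * real a * R) + R\<^sup>2 + \<delta>\<^sup>2 + 2 * (real a)\<^sup>2 - 2 * real a * R"
    using ij pq by (simp add: resistance_sum_spider[OF a1 b1] p q field_simps power2_eq_square)
  have diff: "resistance_sum ?G spider_dist ?u - resistance_sum ?G spider_dist ?v =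
      2 * \<delta> * ((real b - 2) * real a + R)"
    using ij pq by (simp add: resistance_sum_spider[OF a1 b1] p q field_simps power2_eq_square)
  have FF: "F i + F j = 2 * R * \<delta>\<^sup>2 - 4 * \<delta>\<^sup>2 * R + 2 / 3 * (R ^ 3 + 3 * R * \<delta>\<^sup>2) + 4 / 3 * R + (4 * real a - 2 * R) * R\<^sup>2"
    unfolding Fi Fj of_nat_add p q
    by (simp add: field_simps power2_eq_square power3_eq_cube)
  have twelve: "x = y" if "12 * x = 12 * y" for x y :: real using that by simp
  have "2 * (1 + R) * (2 * (resistance_sum ?G spider_dist ?u + resistance_sum ?G spider_dist ?v) + 2 * R -
        2 * (degree_energy ?G spider_dist / vol ?G)) -
      ((vol ?G + 2) * (F i + F j + (real b - 2) * (2 * real a * \<delta>\<^sup>2) + 2 * R\<^sup>2) -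
        (resistance_sum ?G spider_dist ?u - resistance_sum ?G spider_dist ?v)\<^sup>2)
      = - 2 * ((real b - 2) * real a * cross_slope (real a) \<delta> R + cross_offset (real a) \<delta> R)"
    unfolding lin diff V FF cross_slope_def cross_offset_def unfolding vol_spider[OF a1 b1]
    by (rule twelve) (simp add: algebra_simps power2_eq_square power3_eq_cube add_divide_distrib diff_divide_distrib)
  moreover have "0 \<le> (real b - 2) * real a * cross_slope (real a) \<delta> R + cross_offset (real a) \<delta> R"
    using cross_slope_nonneg[OF pq a] cross_offset_nonneg[OF pq a] b unfolding \<delta>_def R_def
    by (intro add_nonneg_nonneg mult_nonneg_nonneg) auto
  moreover have "x - y / (2 * z) \<le> 0" if "2 * z * x - y = - 2 * w" "0 \<le> w" "z > 0" for w x y z :: real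
    using that by (simp add: field_simps)
  ultimately show ?thesis
    unfolding iff not_less using pos by blast
qed

section \<open>Isomorphic graphs\<close>

definition map_graph :: "('a \<Rightarrow> 'b) \<Rightarrow> 'a sgraph \<Rightarrow> 'b sgraph" where
  "map_graph f G = \<lparr>verts = f ` verts G, edges = (\<lambda>e. f ` e) ` edges G\<rparr>"

text \<open>The record type admits edges outside \<open>verts\<close>, whose images under a map
  injective on \<open>verts\<close> could collide with images of nonadjacent pairs.\<close>

definition edges_within_verts :: "'a sgraph \<Rightarrow> bool" where
  "edges_within_verts G \<longleftrightarrow> (\<forall>e\<in>edges G. e \<subseteq> verts G)"

lemma verts_map_graph [simp]: "verts (map_graph f G) = f ` verts G"
  by (simp add: map_graph_def)

lemma edge_map_graph_iff:
  assumes "inj_on f (verts G)" "edges_within_verts G" "e \<subseteq> verts G"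
  shows "f ` e \<in> edges (map_graph f G) \<longleftrightarrow> e \<in> edges G"
  using assms inj_on_image_eq_iff[OF assms(1)] by (fastforce simp: map_graph_def edges_within_verts_def)

lemma nbrs_map_graph:
  assumes f: "inj_on f (verts G)" and G: "edges_within_verts G" and x: "x \<in> verts G"
  shows "nbrs (map_graph f G) (f x) = f ` nbrs G x"
  using edge_map_graph_iff[OF f G, of "{x, _}"] x by (auto simp: nbrs_def)

lemma resistance_map_graph:
  assumes f: "inj_on f (verts G)" and G: "edges_within_verts G" and r: "resistance G r"
  shows "resistance (map_graph f G) (\<lambda>x y. r (inv_into (verts G) f x) (inv_into (verts G) f y))"
    (is "resistance _ ?r")
proof -
  obtain \<tau> where \<tau>: "\<And>x y. x \<in> verts G \<Longrightarrow> y \<in> verts G \<Longrightarrow>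
      (\<Sum>z\<in>nbrs G x. r x y - r z y) = \<tau> x - (if x = y then 2 else 0)"
    using r by (auto simp: resistance_def)
  have inj: "inj_on f (nbrs G x)" for x using f nbrs_subset by (rule inj_on_subset)
  have "walkable (map_graph f G)"
    using r by (auto simp: resistance_def walkable_def nbrs_map_graph[OF f G])
  moreover have "(\<Sum>z\<in>nbrs (map_graph f G) (f x). ?r (f x) (f y) - ?r z (f y)) =
      \<tau> (inv_into (verts G) f (f x)) - (if f x = f y then 2 else 0)" if "x \<in> verts G" "y \<in> verts G" for x y
  proof -
    have "(\<Sum>z\<in>nbrs G x. ?r (f x) (f y) - ?r (f z) (f y)) = (\<Sum>z\<in>nbrs G x. r x y - r z y)"
      using that nbrs_subset[of G x] f by (intro sum.cong) (auto simp: inv_into_f_f)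
    then show ?thesis
      using that f by (simp add: nbrs_map_graph[OF f G] sum.reindex[OF inj] inv_into_f_f \<tau> inj_on_eq_iff)
  qed
  moreover have "?r (f x) (f x) = 0" "?r (f x) (f y) = ?r (f y) (f x)"
    if "x \<in> verts G" "y \<in> verts G" for x y
    using that f r by (auto simp: inv_into_f_f resistance_def)
  ultimately show ?thesis
    unfolding resistance_def by (intro conjI exI[of _ "\<lambda>x. \<tau> (inv_into (verts G) f x)"]) auto
qed

lemma kemeny_map_graph:
  assumes f: "inj_on f (verts G)" and G: "edges_within_verts G" and r: "resistance G r"
  shows "kemeny (map_graph f G) = kemeny G"
proof -
  have deg: "deg (map_graph f G) (f x) = deg G x" if "x \<in> verts G" for x
    using f nbrs_subset[of G x] that by (simp add: nbrs_map_graph[OF f G] card_image inj_on_subset)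
  show ?thesis
    unfolding kemeny_eq[OF r] kemeny_eq[OF resistance_map_graph[OF f G r]] degree_energy_def
    using f by (simp add: sum.reindex deg inv_into_f_f)
qed

lemma add_edge_map_graph: "add_edge (map_graph f G) (f ` e) = map_graph f (add_edge G e)"
  by (simp add: add_edge_def map_graph_def)

lemma nonedges_map_graph:
  assumes f: "inj_on f (verts G)" and G: "edges_within_verts G"
  shows "nonedges (map_graph f G) = (\<lambda>e. f ` e) ` nonedges G"
proof (intro equalityI subsetI)
  fix e assume "e \<in> nonedges (map_graph f G)"
  then obtain u v where uv: "u \<in> verts G" "v \<in> verts G" "f u \<noteq> f v" "e = f ` {u, v}" "e \<notin> edges (map_graph f G)"
    by (auto simp: nonedges_def)
  then have "{u, v} \<in> nonedges G"
    using edge_map_graph_iff[OF f G, of "{u, v}"] by (auto simp: nonedges_def)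
  then show "e \<in> (\<lambda>e. f ` e) ` nonedges G" using uv(4) by blast
next
  fix e assume "e \<in> (\<lambda>e. f ` e) ` nonedges G"
  then obtain u v where uv: "u \<in> verts G" "v \<in> verts G" "u \<noteq> v" "e = f ` {u, v}" "{u, v} \<notin> edges G"
    by (auto simp: nonedges_def)
  then have "f u \<noteq> f v" "e \<notin> edges (map_graph f G)"
    using f edge_map_graph_iff[OF f G, of "{u, v}"] by (auto simp: inj_on_eq_iff)
  then show "e \<in> nonedges (map_graph f G)" using uv by (auto simp: nonedges_def)
qed

text \<open>\<open>shortcut\<close> supplies a resistance for the augmented graph too, so
  \<open>kemeny_map_graph\<close> applies before and after adding an edge; \<open>pos\<close>
  ensures \<open>1 + r u v > 0\<close>.\<close>

lemma num_braess_map_graph: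
  assumes f: "inj_on f (verts G)" and G: "edges_within_verts G" and r: "resistance G r"
    and pos: "\<And>x y. x \<in> verts G \<Longrightarrow> y \<in> verts G \<Longrightarrow> r x y \<ge> 0"
  shows "num_braess (map_graph f G) = num_braess G"
proof -
  have sub: "e \<subseteq> verts G" if "e \<in> nonedges G" for e using that by (auto simp: nonedges_def)
  have "kemeny (add_edge (map_graph f G) (f ` e)) = kemeny (add_edge G e)" if e: "e \<in> nonedges G" for e
  proof -
    obtain u v where uv: "u \<in> verts G" "v \<in> verts G" "u \<noteq> v" "e = {u, v}" "{u, v} \<notin> edges G"
      using e unfolding nonedges_def by blast
    have "edges_within_verts (add_edge G e)"
      using G uv by (auto simp: edges_within_verts_def add_edge_def)
    moreover have "resistance (add_edge G e) (shortcut r u v)"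
      unfolding uv(4) using pos[OF uv(1,2)] by (intro resistance_shortcut[OF r uv(1,2,3,5)]) simp
    ultimately show ?thesis
      unfolding add_edge_map_graph using f by (intro kemeny_map_graph) auto
  qed
  then have "braess_edges (map_graph f G) = (\<lambda>e. f ` e) ` braess_edges G"
    by (auto simp: braess_edges_def nonedges_map_graph[OF f G] kemeny_map_graph[OF f G r])
  moreover have "inj_on (\<lambda>e. f ` e) (braess_edges G)"
    using sub inj_on_image_eq_iff[OF f] by (auto simp: inj_on_def braess_edges_def)
  ultimately show ?thesis by (simp add: num_braess_def card_image)
qed

text \<open>The centre becomes the midpoint \<open>a\<close> of the path; leg 0 runs up from it and
  leg 1 runs down.\<close>

lemma path_graph_eq_map_spider:
  assumes "a \<ge> 1"
  shows "path_graph (2 * a + 1) = map_graph (\<lambda>(i, k). if i = 0 then a + k else a - k) (spider a 2)"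
    (is "_ = map_graph ?f _")
proof -
  have f: "?f (leg_vertex i k) = (if i = 0 then a + k else a - k)" for i k
    by (auto simp: leg_vertex_def)
  have "{..<2 * a + 1} = ?f ` verts (spider a 2)"
  proof (intro equalityI subsetI)
    fix n assume n: "n \<in> {..<2 * a + 1}"
    show "n \<in> ?f ` verts (spider a 2)"
    proof (cases "n \<le> a")
      case True
      then have "n = ?f (leg_vertex 1 (a - n))" unfolding f by simp
      then show ?thesis using leg_vertex_in_spider[of 1 2 "a - n" a] by auto
    next
      case False
      then have "n = ?f (leg_vertex 0 (n - a))" unfolding f by simp
      then show ?thesis using leg_vertex_in_spider[of 0 2 "n - a" a] n False by auto
    qed
  next
    fix n assume "n \<in> ?f ` verts (spider a 2)"
    then obtain x where x: "x \<in> verts (spider a 2)" "n = ?f x" by blast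
    then obtain i k where "x = leg_vertex i k" "k \<le> a" by (auto simp: verts_spider)
    with x(2) have "n = ?f (leg_vertex i k)" "k \<le> a" by simp_all
    then show "n \<in> {..<2 * a + 1}" unfolding f by auto
  qed
  moreover have "{{n, Suc n} | n. Suc n < 2 * a + 1} = (\<lambda>e. ?f ` e) ` edges (spider a 2)"
  proof (intro equalityI subsetI)
    fix e assume "e \<in> {{n, Suc n} | n. Suc n < 2 * a + 1}"
    then obtain n where n: "e = {n, Suc n}" "n < 2 * a" by auto
    show "e \<in> (\<lambda>e. ?f ` e) ` edges (spider a 2)"
    proof (cases "n < a")
      case True
      then have "e = ?f ` {leg_vertex 1 (a - Suc n), leg_vertex 1 (Suc (a - Suc n))}"
        unfolding image_insert f n by auto
      moreover have "{leg_vertex 1 (a - Suc n), leg_vertex 1 (Suc (a - Suc n))} \<in> edges (spider a 2)"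
        using True by (subst spider_edge_iff) auto
      ultimately show ?thesis by blast
    next
      case False
      then have "e = ?f ` {leg_vertex 0 (n - a), leg_vertex 0 (Suc (n - a))}"
        unfolding image_insert f n by auto
      moreover have "{leg_vertex 0 (n - a), leg_vertex 0 (Suc (n - a))} \<in> edges (spider a 2)"
        using False n by (subst spider_edge_iff) auto
      ultimately show ?thesis by blast
    qed
  next
    fix e assume "e \<in> (\<lambda>e. ?f ` e) ` edges (spider a 2)"
    then obtain i k where e: "e = ?f ` {leg_vertex i k, leg_vertex i (Suc k)}" "k < a"
      by (auto simp: spider_def)
    show "e \<in> {{n, Suc n} | n. Suc n < 2 * a + 1}"
    proof (cases "i = 0")
      case True
      then have "e = {a + k, Suc (a + k)}" unfolding e image_insert f by auto
      then show ?thesis using e(2) by auto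
    next
      case False
      then have "e = {a - Suc k, Suc (a - Suc k)}" unfolding e image_insert f using e(2) by auto
      then show ?thesis using e(2) by auto
    qed
  qed
  ultimately show ?thesis by (simp add: path_graph_def map_graph_def)
qed

lemma num_braess_path_graph:
  assumes a: "a \<ge> 1"
  shows "num_braess (path_graph (2 * a + 1)) = num_braess (spider a 2)"
  unfolding path_graph_eq_map_spider[OF a]
proof (rule num_braess_map_graph[OF _ _ resistance_spider[OF a]])
  show "inj_on (\<lambda>(i, k). if i = 0 then a + k else a - k) (verts (spider a 2))"
    by (auto simp: inj_on_def verts_spider leg_vertex_def less_2_cases_iff)
  show "edges_within_verts (spider a 2)"
    by (force simp: edges_within_verts_def spider_def)
qed (auto simp: spider_dist_def)

section \<open>Harmonic sums\<close>

lemma square_minus_self_plus_one_pos: "x\<^sup>2 - x + 1 > (0 :: real)"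
proof -
  have "x\<^sup>2 - x + 1 = (x - 1 / 2)\<^sup>2 + 3 / 4" by (simp add: power2_eq_square field_simps)
  then show ?thesis using zero_le_power2[of "x - 1 / 2"] by linarith
qed

lemma T1_term_eq: "l \<ge> 1 \<Longrightarrow> T1_term l = (real l - 1) / (real l * ((real l)\<^sup>2 - real l + 1))"
proof -
  assume l: "l \<ge> 1"
  show ?thesis using l square_minus_self_plus_one_pos[of "real l"] by (simp add: T1_term_def divide_simps) (simp add: algebra_simps power2_eq_square)
qed

lemma T1_term_bounds:
  assumes l: "l \<ge> 1"
  shows "0 \<le> T1_term l" "T1_term l \<le> inverse ((real l)\<^sup>2)"
proof -
  have q: "(real l)\<^sup>2 - real l + 1 > 0" by (rule square_minus_self_plus_one_pos)
  then show "0 \<le> T1_term l" unfolding T1_term_eq[OF l] using l by simp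
  have "(real l - 1) * (real l)\<^sup>2 \<le> real l * ((real l)\<^sup>2 - real l + 1)"
    by (simp add: power2_eq_square algebra_simps)
  then show "T1_term l \<le> inverse ((real l)\<^sup>2)"
    unfolding T1_term_eq[OF l] using l q by (simp add: divide_simps)
qed

lemma summable_T1_term: "summable (\<lambda>l. \<bar>T1_term (l + 3)\<bar>)"
proof (rule summable_comparison_test_ev)
  show "summable (\<lambda>l. inverse ((real (l + 3))\<^sup>2))"
    using summable_ignore_initial_segment[OF inverse_power_summable[of 2, where 'a = real], of 3] by simp
  show "\<forall>\<^sub>F l in sequentially. norm \<bar>T1_term (l + 3)\<bar> \<le> inverse ((real (l + 3))\<^sup>2)"
    using T1_term_bounds[of "_ + 3"] by (intro always_eventually) auto
qed

lemma sum_T1_term_le: "(\<Sum>l=3..n. T1_term l) \<le> T1_inf"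
proof -
  have "(\<Sum>l=3..n. T1_term l) = (\<Sum>l<n - 2. T1_term (l + 3))"
    by (rule sum.reindex_bij_witness[of _ "\<lambda>l. l + 3" "\<lambda>l. l - 3"]) auto
  also have "\<dots> \<le> T1_inf"
    unfolding T1_inf_def using summable_T1_term[THEN summable_rabs_cancel] T1_term_bounds(1)
    by (intro sum_le_suminf) auto
  finally show ?thesis .
qed

text \<open>\<open>euler_mascheroni_bounds\<close> compares with \<open>ln (n + 1)\<close>; passing
  to \<open>ln n\<close> costs at most \<open>1 / n\<close>.\<close>

lemma harm_le_ln:
  assumes "n \<ge> 1"
  shows "(harm n :: real) \<le> ln (real n) + euler_mascheroni + 1 / real n"
proof -
  have "harm n - ln (real (Suc n)) + inverse (real (2 * (n + 1))) \<le> euler_mascheroni"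
    using euler_mascheroni_bounds[OF assms] by simp
  moreover have "inverse (real (2 * (n + 1))) \<ge> 0" by simp
  ultimately have "harm n - ln (real (Suc n)) \<le> euler_mascheroni" by linarith
  then show ?thesis using ln_diff_le_inverse[of "real n"] assms by (simp add: add.commute)
qed

lemma sum_inverse_from_3:
  assumes "n \<ge> 2"
  shows "(\<Sum>l=3..n. 1 / real l) = harm n - 3 / 2"
  using assms
proof (induction n rule: dec_induct)
  case base
  then show ?case by (simp add: harm_def numeral_2_eq_2)
qed (simp add: harm_Suc inverse_eq_divide)

lemma sum_from_3: "n \<ge> 2 \<Longrightarrow> (\<Sum>l=3..n. real l) = real n * (real n + 1) / 2 - 3"
  by (induction n rule: dec_induct) (auto simp: field_simps)

text \<open>The threshold for \<open>c\<close>: with \<open>R = l - 1\<close>, the excess is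
  negative iff \<open>c < leg_bound a l\<close>.\<close>

definition leg_bound :: "real \<Rightarrow> nat \<Rightarrow> real" where
  "leg_bound a l = real l / ((real l)\<^sup>2 - real l + 1) * (a - ((real l)\<^sup>2 - 1) / 3)"

text \<open>The leading quotient is \<open>T1_term l + 1 / l\<close>; the subtracted part is at
  least \<open>l / 3\<close> because \<open>l\<^sup>2 - 1 \<ge> l\<^sup>2 - l + 1\<close> for
  \<open>l \<ge> 2\<close>.\<close>

lemma leg_bound_le:
  assumes l: "l \<ge> 2"
  shows "leg_bound a l \<le> a * (T1_term l + 1 / real l) - real l / 3"
proof -
  have q: "(real l)\<^sup>2 - real l + 1 > 0" by (rule square_minus_self_plus_one_pos)
  have "1 \<le> ((real l)\<^sup>2 - 1) / ((real l)\<^sup>2 - real l + 1)"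
    using l q by (simp add: le_divide_eq)
  then have "real l / 3 * 1 \<le> real l / 3 * (((real l)\<^sup>2 - 1) / ((real l)\<^sup>2 - real l + 1))"
    by (intro mult_left_mono) auto
  moreover have "leg_bound a l =
      a * (T1_term l + 1 / real l) - real l / 3 * (((real l)\<^sup>2 - 1) / ((real l)\<^sup>2 - real l + 1))"
    unfolding leg_bound_def T1_term_def by (simp add: right_diff_distrib diff_divide_distrib mult.commute)
  ultimately show ?thesis by simp
qed

text \<open>With \<open>s\<^sup>2 = 3 * a + 1\<close>, the harmonic sum contributes
  \<open>ln s + euler_mascheroni - 3 / 2\<close> per unit of \<open>a\<close>. The subtracted sum of
  \<open>l / 3\<close> is about \<open>s\<^sup>2 / 6\<close>, hence about \<open>a / 2\<close>,
  which turns \<open>- 3 / 2\<close> into \<open>- 2\<close>. The rest is of order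
  \<open>s\<close>.\<close>

lemma sum_leg_bound_le:
  fixes a :: nat
  assumes a: "a \<ge> 1"
  defines "n \<equiv> nat \<lfloor>sqrt (3 * real a + 1)\<rfloor>"
  shows "(\<Sum>l=3..n. leg_bound a l + 1) \<le>
    (1 / 2 * ln (3 * real a + 1) + T1_inf + euler_mascheroni - 2) * real a + 3 * sqrt (3 * real a + 1)"
proof -
  define s where "s = sqrt (3 * real a + 1)"
  have s2: "s * s = 3 * real a + 1" unfolding s_def by simp
  have s: "s \<ge> 2" unfolding s_def using a by (intro real_le_rsqrt) simp
  have n: "real n \<le> s" "s < real n + 1" "n \<ge> 2"
    using s unfolding n_def s_def[symmetric] by linarith+
  have "(\<Sum>l=3..n. leg_bound a l + 1) \<le> (\<Sum>l=3..n. real a * (T1_term l + 1 / real l) - real l / 3 + 1)"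
    using leg_bound_le by (intro sum_mono) auto
  also have "\<dots> = real a * ((\<Sum>l=3..n. T1_term l) + (harm n - 3 / 2)) -
      (real n * (real n + 1) / 2 - 3) / 3 + (real n - 2)"
    using n(3) unfolding sum_inverse_from_3[OF n(3), symmetric] sum_from_3[OF n(3), symmetric]
    by (simp add: sum.distrib sum_subtractf sum_distrib_left[symmetric] sum_divide_distrib[symmetric] of_nat_diff)
  also have "\<dots> \<le> real a * (T1_inf + (ln s + euler_mascheroni + 1 / real n - 3 / 2)) -
      ((s - 1) * s / 2 - 3) / 3 + s"
  proof -
    have "harm n \<le> ln s + euler_mascheroni + 1 / real n"
      using harm_le_ln[of n] n ln_le_cancel_iff[of "real n" s] by linarith
    then have "real a * ((\<Sum>l=3..n. T1_term l) + (harm n - 3 / 2)) \<le>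
        real a * (T1_inf + (ln s + euler_mascheroni + 1 / real n - 3 / 2))"
      using sum_T1_term_le[of n] by (intro mult_left_mono) auto
    moreover have "(s - 1) * s \<le> real n * (real n + 1)" using n s by (intro mult_mono) auto
    moreover have "x - (y / 2 - 3) / 3 + (z - 2) \<le> x' - (y' / 2 - 3) / 3 + z'"
      if "x \<le> x'" "y' \<le> y" "z \<le> z'" for x x' y y' z z' :: real
      using that by (simp add: field_simps)
    ultimately show ?thesis using n(1) by blast
  qed
  also have "\<dots> = real a * (T1_inf + ln s + euler_mascheroni - 2) + real a / real n + 7 / 6 * s + 5 / 6"
    by (simp add: algebra_simps diff_divide_distrib add_divide_distrib s2)
  also have "\<dots> \<le> real a * (T1_inf + ln s + euler_mascheroni - 2) + 3 * s"
  proof -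
    \<comment> \<open>From \<open>n > s - 1 \<ge> s / 2\<close> and \<open>a \<le> s * s / 3\<close>
      one gets \<open>a / n \<le> 2 / 3 * s\<close>, and adding \<open>7 / 6 * s + 5 / 6\<close>
      stays below \<open>3 * s\<close> for \<open>s \<ge> 2\<close>.\<close>
    have "s / 2 \<le> real n" using n s by linarith
    have "real a \<le> s * s / 3" using s2 by simp
    also have "\<dots> \<le> 2 / 3 * s * real n"
      using mult_left_mono[OF \<open>s / 2 \<le> real n\<close>, of "2 / 3 * s"] s by simp
    finally have "real a / real n \<le> 2 / 3 * s" using n by (simp add: divide_le_eq)
    then show ?thesis using s by simp
  qed
  also have "ln s = 1 / 2 * ln (3 * real a + 1)" unfolding s_def by (simp add: ln_sqrt)
  finally show ?thesis unfolding s_def by (simp add: algebra_simps)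
qed

section \<open>Counting Braess edges\<close>

text \<open>\<open>p = 0\<close> is allowed, so pairs containing the centre are counted with the leg
  of their other vertex.\<close>

definition leg_braess_pairs :: "nat \<Rightarrow> nat \<Rightarrow> (nat \<times> nat) set" where
  "leg_braess_pairs a b = {(p, q). Suc p < q \<and> q \<le> a \<and>
     braess_gain (real a * real b) (real a) (real (a - q)) (real (q - p)) > 0}"

lemma finite_leg_braess_pairs: "finite (leg_braess_pairs a b)"
  by (rule finite_subset[of _ "{..a} \<times> {..a}"]) (auto simp: leg_braess_pairs_def)

text \<open>A pair containing the centre falls under \<open>same\<close>, since
  \<open>leg_vertex i 0\<close> does not depend on \<open>i\<close>. In both cases the vertices are
  ordered by depth.\<close>

lemma spider_nonedge_cases:
  assumes "e \<in> nonedges (spider a b)"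
  obtains (same) i p q where "i < b" "Suc p < q" "q \<le> a" "e = {leg_vertex i p, leg_vertex i q}"
  | (cross) i j p q where "i < b" "j < b" "i \<noteq> j" "1 \<le> p" "p \<le> q" "q \<le> a" "e = {leg_vertex i p, leg_vertex j q}"
proof -
  obtain u v where uv: "u \<in> verts (spider a b)" "v \<in> verts (spider a b)" "u \<noteq> v" "e = {u, v}" "e \<notin> edges (spider a b)"
    using assms unfolding nonedges_def by blast
  obtain i p where u: "u = leg_vertex i p" "i < b" "p \<le> a" using uv(1) by (auto simp: verts_spider)
  obtain j q where v: "v = leg_vertex j q" "j < b" "q \<le> a" using uv(2) by (auto simp: verts_spider)
  have ordered: thesis
    if "i < b" "p \<le> a" "j < b" "q \<le> a" "leg_vertex i p \<noteq> leg_vertex j q" "p \<le> q"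
      "e = {leg_vertex i p, leg_vertex j q}" for i j p q
  proof (cases "p = 0 \<or> i = j")
    case True
    then have e: "e = {leg_vertex j p, leg_vertex j q}" using that(7) by (auto simp: leg_vertex_0[of i] leg_vertex_0[of j])
    have "p \<noteq> q" using True that(5) by auto
    moreover have "q \<noteq> Suc p" using uv(5)[unfolded e] spider_edge_iff[of j b p a j q] that by simp
    ultimately show thesis using that(3,4,6) e by (intro same[of j p q]) auto
  next
    case False
    then show thesis using that by (intro cross[of i j p q]) auto
  qed
  show thesis
  proof (cases "p \<le> q")
    case True
    then show thesis using ordered[of i p j q] u v uv by simp
  next
    case False
    then show thesis using ordered[of j q i p] u v uv by (simp add: insert_commute)
  qed
qed

lemma braess_edges_spider:
  assumes a: "a \<ge> 2" and b: "b \<ge> 2"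
  shows "braess_edges (spider a b) =
    (\<lambda>(i, p, q). {leg_vertex i p, leg_vertex i q}) ` ({..<b} \<times> leg_braess_pairs a b)" (is "_ = ?f ` ?S")
proof (intro equalityI subsetI)
  fix e assume e: "e \<in> braess_edges (spider a b)"
  then have ne: "e \<in> nonedges (spider a b)" and gt: "kemeny (add_edge (spider a b) e) > kemeny (spider a b)"
    by (auto simp: braess_edges_def)
  from ne show "e \<in> ?f ` ?S"
  proof (cases rule: spider_nonedge_cases)
    case (same i p q)
    then have "(i, p, q) \<in> ?S"
      using gt kemeny_spider_same_leg[of a b i p q] a b by (simp add: leg_braess_pairs_def)
    then show ?thesis using same(4) by force
  next
    case (cross i j p q)
    then show ?thesis using not_kemeny_spider_cross_legs[OF a b, of i j p q] gt by simp
  qed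
next
  fix e assume "e \<in> ?f ` ?S"
  then obtain i p q where i: "i < b" and pq: "(p, q) \<in> leg_braess_pairs a b"
    and e: "e = {leg_vertex i p, leg_vertex i q}" by auto
  have pq': "Suc p < q" "q \<le> a" using pq by (auto simp: leg_braess_pairs_def)
  have "leg_vertex i p \<in> verts (spider a b)" "leg_vertex i q \<in> verts (spider a b)"
    using i pq' by (auto intro!: leg_vertex_in_spider)
  moreover have "leg_vertex i p \<noteq> leg_vertex i q" using pq' by simp
  moreover have "e \<notin> edges (spider a b)" using i pq' unfolding e by (subst spider_edge_iff) auto
  ultimately have "e \<in> nonedges (spider a b)" unfolding nonedges_def e by blast
  moreover have "kemeny (add_edge (spider a b) e) > kemeny (spider a b)"
    unfolding e using pq a b i pq'
    by (subst kemeny_spider_same_leg) (auto simp: leg_braess_pairs_def simp del: of_nat_diff)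
  ultimately show "e \<in> braess_edges (spider a b)" by (simp add: braess_edges_def)
qed

lemma num_braess_spider:
  assumes a: "a \<ge> 2" and b: "b \<ge> 2"
  shows "num_braess (spider a b) = b * card (leg_braess_pairs a b)"
proof -
  \<comment> \<open>\<open>p < q\<close> tells the two vertices apart, and the positive depth
    \<open>q\<close> determines the leg.\<close>
  have "inj_on (\<lambda>(i, p, q). {leg_vertex i p, leg_vertex i q}) ({..<b} \<times> leg_braess_pairs a b)"
    by (auto simp: inj_on_def leg_braess_pairs_def doubleton_eq_iff)
  then show ?thesis
    by (simp add: num_braess_def braess_edges_spider[OF a b] card_image card_cartesian_product)
qed

lemma leg_braess_pairs_excess:
  assumes b: "b \<ge> 2" and pq: "(p, q) \<in> leg_braess_pairs a b"
  shows "braess_excess (real a) (real (a - q)) (real (q - p)) < 0"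
proof (rule ccontr)
  assume "\<not> ?thesis"
  then have "braess_gain (real a * real b) (real a) (real (a - q)) (real (q - p)) \<le> 0"
    using pq b by (intro braess_gain_nonpos) (auto simp: leg_braess_pairs_def of_nat_diff)
  then show False using pq by (auto simp: leg_braess_pairs_def)
qed

text \<open>\<open>b\<close> enters the gain only through \<open>- (a * b * E)\<close>, and
  membership forces \<open>E < 0\<close>, so the gain does not decrease with
  \<open>b\<close>.\<close>

lemma leg_braess_pairs_mono:
  assumes b: "2 \<le> b" "b \<le> b'"
  shows "leg_braess_pairs a b \<subseteq> leg_braess_pairs a b'"
proof clarify
  fix p q assume pq: "(p, q) \<in> leg_braess_pairs a b"
  define E where "E = braess_excess (real a) (real (a - q)) (real (q - p))"
  have "E < 0" unfolding E_def by (rule leg_braess_pairs_excess[OF b(1) pq])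
  then have "real a * real b' * E \<le> real a * real b * E"
    using b(2) by (intro mult_right_mono_neg mult_left_mono) auto
  then have "braess_gain (real a * real b) (real a) (real (a - q)) (real (q - p)) \<le>
      braess_gain (real a * real b') (real a) (real (a - q)) (real (q - p))"
    unfolding braess_gain_def E_def[symmetric] by linarith
  then show "(p, q) \<in> leg_braess_pairs a b'"
    using pq by (simp add: leg_braess_pairs_def del: of_nat_diff)
qed

text \<open>Pairs are encoded by \<open>l = q - p + 1\<close> and \<open>c = a - q\<close>. For each
  \<open>l\<close>, negative excess confines \<open>c\<close> to the naturals below
  \<open>leg_bound\<close>, of which there are at most \<open>leg_bound + 1\<close>.\<close>

lemma card_leg_braess_pairs_le:
  assumes b: "b \<ge> 2"
  shows "real (card (leg_braess_pairs a b)) \<le> (\<Sum>l=3..nat \<lfloor>sqrt (3 * real a + 1)\<rfloor>. leg_bound (real a) l + 1)"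
proof -
  let ?n = "nat \<lfloor>sqrt (3 * real a + 1)\<rfloor>"
  let ?C = "\<lambda>l. nat \<lceil>leg_bound (real a) l\<rceil>"
  let ?g = "\<lambda>(p, q). (Suc (q - p), a - q)"
  have img: "?g ` leg_braess_pairs a b \<subseteq> (SIGMA l:{3..?n}. {..<?C l})"
  proof (rule image_subsetI)
    fix z assume "z \<in> leg_braess_pairs a b"
    then obtain p q where z: "z = (p, q)" and pq: "(p, q) \<in> leg_braess_pairs a b"
      by (cases z) auto
    define l where "l = Suc (q - p)"
    define c where "c = real (a - q)"
    have l: "l \<ge> 3" using pq by (auto simp: l_def leg_braess_pairs_def)
    have R: "real (q - p) = real l - 1" by (simp add: l_def)
    define D where "D = (real l)\<^sup>2 - real l + 1"
    have D: "D > 0" unfolding D_def by (rule square_minus_self_plus_one_pos)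
    have "c * D / real l + ((real l)\<^sup>2 - 1) / 3 < real a"
      using leg_braess_pairs_excess[OF b pq] unfolding braess_excess_def R c_def[symmetric] D_def
      by (simp add: power2_eq_square algebra_simps)
    then have cl: "c * D / real l < real a - ((real l)\<^sup>2 - 1) / 3" by simp
    then have "c < leg_bound (real a) l"
      using l D unfolding leg_bound_def D_def[symmetric] by (simp add: field_simps)
    then have "a - q < ?C l" unfolding c_def by linarith
    moreover have "l \<le> ?n"
    proof -
      \<comment> \<open>As \<open>c \<ge> 0\<close>, negative excess alone bounds \<open>l\<close>;
        this is the origin of the cutoff.\<close>
      have "c * D / real l \<ge> 0" using D by (simp add: c_def)
      then have "((real l)\<^sup>2 - 1) / 3 < real a" using cl by linarith
      then have "(real l)\<^sup>2 \<le> 3 * real a + 1" by simp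
      then have "real l \<le> sqrt (3 * real a + 1)" by (rule real_le_rsqrt)
      then show ?thesis by linarith
    qed
    ultimately show "?g z \<in> (SIGMA l:{3..?n}. {..<?C l})"
      using l by (simp add: l_def z)
  qed
  have "inj_on ?g (leg_braess_pairs a b)"
    by (auto simp: inj_on_def leg_braess_pairs_def)
  then have "card (leg_braess_pairs a b) \<le> card (SIGMA l:{3..?n}. {..<?C l})"
    using img by (intro card_inj_on_le[of ?g]) auto
  also have "\<dots> = (\<Sum>l=3..?n. ?C l)" by (simp add: card_SigmaI)
  finally have "real (card (leg_braess_pairs a b)) \<le> real (\<Sum>l=3..?n. ?C l)" by (rule of_nat_mono)
  also have "\<dots> = (\<Sum>l=3..?n. real (?C l))" by (rule of_nat_sum)
  also have "\<dots> \<le> (\<Sum>l=3..?n. leg_bound (real a) l + 1)"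
  proof (rule sum_mono)
    fix l assume "l \<in> {3..?n}"
    \<comment> \<open>Up to the cutoff \<open>leg_bound\<close> is nonnegative; on very negative
      values \<open>nat\<close> would truncate to 0 and the bound \<open>leg_bound + 1\<close> would
      fail.\<close>
    then have "real l \<le> sqrt (3 * real a + 1)" "l \<ge> 3" by (auto simp: le_nat_floor) linarith+
    then have "(real l)\<^sup>2 \<le> 3 * real a + 1" using power_mono[of "real l" "sqrt (3 * real a + 1)" 2] by simp
    then have "leg_bound (real a) l \<ge> 0"
      unfolding leg_bound_def using square_minus_self_plus_one_pos[of "real l"]
      by (intro mult_nonneg_nonneg divide_nonneg_pos) auto
    then show "real (?C l) \<le> leg_bound (real a) l + 1" by linarith
  qed
  finally show ?thesis .
qed

theorem theorem4p8:
  shows "summable (\<lambda>l. \<bar>T1_term (l + 3)\<bar>) \<and>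
    (\<exists>r :: nat \<Rightarrow> real. r \<in> o[at_top](\<lambda>a. real a) \<and>
      (\<forall>a b :: nat. a \<ge> 2 \<and> b \<ge> 2 \<longrightarrow>
        real b / 2 * real (num_braess (path_graph (2 * a + 1))) \<le> real (num_braess (spider a b)) \<and>
        real (num_braess (spider a b)) \<le>
          (1 / 2 * ln (3 * real a + 1) + T1_inf + (euler_mascheroni :: real) - 2) * (real a * real b)
            + r a * real b))"
proof (intro conjI exI[of _ "\<lambda>a. 3 * sqrt (3 * real a + 1)"] allI impI)
  show "summable (\<lambda>l. \<bar>T1_term (l + 3)\<bar>)" by (rule summable_T1_term)
  \<comment> \<open>The witness for the \<open>o(a)\<close> term is the error term of
    \<open>sum_leg_bound_le\<close>.\<close>
  show "(\<lambda>a. 3 * sqrt (3 * real a + 1)) \<in> o[at_top](\<lambda>a. real a)" by real_asymp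
  fix a b :: nat
  assume "a \<ge> 2 \<and> b \<ge> 2"
  then have a: "a \<ge> 2" and b: "b \<ge> 2" by auto
  \<comment> \<open>The path has \<open>2 * card (leg_braess_pairs a 2)\<close> Braess edges, so the
    factor \<open>b / 2\<close> reduces the lower bound to a comparison of single legs.\<close>
  have "card (leg_braess_pairs a 2) \<le> card (leg_braess_pairs a b)"
    using b by (intro card_mono finite_leg_braess_pairs leg_braess_pairs_mono) auto
  then show "real b / 2 * real (num_braess (path_graph (2 * a + 1))) \<le> real (num_braess (spider a b))"
    using a b unfolding num_braess_path_graph[of a, OF order_trans[OF one_le_numeral a]]
    by (simp add: num_braess_spider mult_left_mono)
  have "real (card (leg_braess_pairs a b)) \<le>
      (1 / 2 * ln (3 * real a + 1) + T1_inf + euler_mascheroni - 2) * real a + 3 * sqrt (3 * real a + 1)"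
    using order_trans[OF card_leg_braess_pairs_le[OF b] sum_leg_bound_le] a by simp
  from mult_right_mono[OF this, of "real b"]
  show "real (num_braess (spider a b)) \<le>
      (1 / 2 * ln (3 * real a + 1) + T1_inf + (euler_mascheroni :: real) - 2) * (real a * real b)
        + 3 * sqrt (3 * real a + 1) * real b"
    by (simp add: num_braess_spider[OF a b] algebra_simps)
qed

end
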